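(* For every integer $k\ge 3$, \[ \mathcal C_{k}(n)= O\left( n^{2k/5+ 1+\gamma(k)}\right), \] where \[ \gamma(k) = \begin{cases} \frac{1}{75}\cdot\left( 4 - 4\cdot (-1/4)^{k/4} \right) & \text{ if } k \equiv 0 \pmod{4}, \\ \frac{1}{75}\cdot\left( 4 - 9\cdot (-1/4)^{\lfloor k/4\rfloor} \right) & \text{ if } k \equiv 1 \pmod{4}, \\ \frac{1}{75}\cdot\left( 4 + 11\cdot (-1/4)^{\lfloor k/4\rfloor} \right) & \text{ if } k \equiv 2 \pmod{4}, \\ \frac{1}{75}\cdot\left( 4 - \frac{13}{2} \cdot (-1/4)^{\lfloor k/4\rfloor} \right) & \text{ if } k \equiv 3 \pmod{4}. \end{cases} \] (Here $k$ is a fixed constant and the implied constant may depend on $k$.)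
   Context: For points $p,q\in\mathbb{R}^2$, $|pq|$ denotes the Euclidean distance. Given a finite set $\mathcal P\subset\mathbb{R}^2$, a positive integer $k$, and a sequence of positive distances $(\delta_1,\ldots,\delta_k)$, a $k$-chain is a $(k+1)$-tuple of distinct points $(p_1,\ldots,p_{k+1})\in\mathcal P^{k+1}$ with $|p_jp_{j+1}|=\delta_j$ for every $1\le j\le k$. $\mathcal C_k(n)$ denotes the maximum, over all sets $\mathcal P$ of $n$ points in $\mathbb{R}^2$ and all sequences of distances $(\delta_1,\ldots,\delta_k)$, of the number of $k$-chains. *)

theory Defs
  imports "HOL-Analysis.Analysis" "HOL-Library.Landau_Symbols"
begin

(* Tuples and distance sequences are lists, so the 1-based p_j and delta_j are
   ps ! (j - 1) and ds ! (j - 1). *)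
definition k_chains :: "nat \<Rightarrow> (real^2) set \<Rightarrow> real list \<Rightarrow> (real^2) list set" where
  "k_chains k P ds =
     {ps. length ps = k + 1 \<and> set ps \<subseteq> P \<and> distinct ps \<and>
          (\<forall>j<k. dist (ps ! j) (ps ! (j + 1)) = ds ! j)}"

definition chain_counts :: "nat \<Rightarrow> nat \<Rightarrow> nat set" where
  "chain_counts k n =
     {card (k_chains k P ds) | P ds.
        finite P \<and> card P = n \<and> length ds = k \<and> (\<forall>\<delta>\<in>set ds. \<delta> > 0)}"

definition max_chains :: "nat \<Rightarrow> nat \<Rightarrow> nat" where
  "max_chains k n = Max (chain_counts k n)"

definition chain_gamma :: "nat \<Rightarrow> real" where
  "chain_gamma k =
     (if k mod 4 = 0 then 1/75 * (4 - 4 * (-1/4) ^ (k div 4))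
      else if k mod 4 = 1 then 1/75 * (4 - 9 * (-1/4) ^ (k div 4))
      else if k mod 4 = 2 then 1/75 * (4 + 11 * (-1/4) ^ (k div 4))
      else 1/75 * (4 - 13/2 * (-1/4) ^ (k div 4)))"

lemma k_chains_subset: "k_chains k P ds \<subseteq> {ps. set ps \<subseteq> P \<and> length ps = k + 1}"
  by (auto simp: k_chains_def)

lemma finite_k_chains: "finite P \<Longrightarrow> finite (k_chains k P ds)"
  by (rule finite_subset[OF k_chains_subset]) (rule finite_lists_length_eq)

lemma card_k_chains_le:
  assumes "finite P"
  shows "card (k_chains k P ds) \<le> card P ^ (k + 1)"
  using card_mono[OF finite_lists_length_eq[OF assms] k_chains_subset, of k ds]
  by (simp only: card_lists_length_eq[OF assms])

(* The next two facts show that the Max in max_chains ranges over a finite nonempty set. *)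
lemma finite_chain_counts: "finite (chain_counts k n)"
proof (rule finite_subset)
  show "chain_counts k n \<subseteq> {..n ^ (k + 1)}"
    unfolding chain_counts_def using card_k_chains_le by blast
qed simp

lemma chain_counts_nonempty: "chain_counts k n \<noteq> {}"
proof -
  have "infinite (UNIV :: (real^2) set)"
    by (rule infinite_UNIV_vec) (rule infinite_UNIV_char_0)
  then obtain P :: "(real^2) set" where "finite P" "card P = n"
    using infinite_arbitrarily_large by blast
  then have "card (k_chains k P (replicate k 1)) \<in> chain_counts k n"
    unfolding chain_counts_def by (auto intro!: exI[of _ P] exI[of _ "replicate k 1"])
  then show ?thesis by blast
qed

end

theory Submission
  imports Defs
begin

text \<open>
  Let \<open>E k\<close> be the claimed exponent. It satisfies \<open>E (k + 3) = (E k + E (k + 1)) / 2 + 1\<close> with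
  \<open>E 0 = 1\<close>, \<open>E 1 = 4/3\<close>, \<open>E 2 = 2\<close>, so it suffices to show that, up to a constant,
  \<open>C (k + 3) \<le> t\<^sup>2 C (k + 1) + (n\<^sup>2 / t\<^sup>2 + n) C k\<close> for every threshold \<open>t > 0\<close>. If the second
  and the penultimate point of a chain both have at most \<open>t\<close> neighbours at the respective distance,
  deleting the two end points gives the first term. Otherwise one of them, say the second, is heavy;
  by the Szemeredi-Trotter bound there are \<open>O(n\<^sup>2 / t\<^sup>2 + n)\<close> choices for the first two points, and
  the third one is determined up to two choices by its neighbours, which gives the second term.

  The incidence bound follows Szekely: upper (or lower) semicircles of a fixed radius are
  \<open>x\<close>-monotone and meet pairwise at most once, so the arcs between consecutive points form a simple
  graph drawn with few crossings, to which the crossing lemma applies. Its base case, that a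
  crossing-free \<open>x\<close>-monotone drawing has at most \<open>3 |V|\<close> edges, needs no Euler formula: every edge is
  the highest one leaving its left end, the highest one arriving at its right end, or the highest one
  passing below some vertex, and each vertex serves at most one edge in each of these roles.
\<close>

section \<open>Drawings by \<open>x\<close>-monotone curves\<close>

lemma vec2_eqI: "a $ 1 = b $ 1 \<Longrightarrow> a $ 2 = b $ 2 \<Longrightarrow> a = (b :: real^2)"
  by (simp add: vec_eq_iff forall_2)

locale xmonotone_drawing =
  fixes V :: "(real^2) set" and E :: "'e set" and L R :: "'e \<Rightarrow> real^2" and g :: "'e \<Rightarrow> real \<Rightarrow> real"
  assumes finite_V: "finite V" and finite_E: "finite E"
    and L_in: "e \<in> E \<Longrightarrow> L e \<in> V" and R_in: "e \<in> E \<Longrightarrow> R e \<in> V"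
    and L_less_R: "e \<in> E \<Longrightarrow> L e $ 1 < R e $ 1"
    and continuous_on_g: "e \<in> E \<Longrightarrow> continuous_on {L e $ 1..R e $ 1} (g e)"
    and g_L: "e \<in> E \<Longrightarrow> g e (L e $ 1) = L e $ 2" and g_R: "e \<in> E \<Longrightarrow> g e (R e $ 1) = R e $ 2"
    and vertex_free: "e \<in> E \<Longrightarrow> v \<in> V \<Longrightarrow> L e $ 1 < v $ 1 \<Longrightarrow> v $ 1 < R e $ 1 \<Longrightarrow> g e (v $ 1) \<noteq> v $ 2"
    and simple: "e \<in> E \<Longrightarrow> d \<in> E \<Longrightarrow> L e = L d \<Longrightarrow> R e = R d \<Longrightarrow> e = d"
begin

definition inner_proj :: "'e \<Rightarrow> real set" where
  "inner_proj e = {L e $ 1<..<R e $ 1}"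

definition crosses :: "'e \<Rightarrow> 'e \<Rightarrow> bool" where
  "crosses e d \<longleftrightarrow> e \<noteq> d \<and> (\<exists>x\<in>inner_proj e \<inter> inner_proj d. g e x = g d x)"

definition crossings :: "('e \<times> 'e) set" where
  "crossings = {(e, d). e \<in> E \<and> d \<in> E \<and> crosses e d}"

lemma finite_crossings: "finite crossings"
  by (rule finite_subset[of _ "E \<times> E"]) (auto simp: crossings_def finite_E)

lemma vertex_on_edge:
  assumes "e \<in> E" "v \<in> V" "L e $ 1 \<le> v $ 1" "v $ 1 \<le> R e $ 1" "g e (v $ 1) = v $ 2"
  shows "v = L e \<or> v = R e"
proof -
  consider "v $ 1 = L e $ 1" | "v $ 1 = R e $ 1" using vertex_free[OF assms(1,2)] assms(3-5) by linarith
  then show ?thesis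
  proof cases
    case 1
    then have "v $ 2 = L e $ 2" using g_L[OF assms(1)] assms(5) by simp
    then show ?thesis using 1 vec2_eqI by blast
  next
    case 2
    then have "v $ 2 = R e $ 2" using g_R[OF assms(1)] assms(5) by simp
    then show ?thesis using 2 vec2_eqI by blast
  qed
qed

lemma subdrawing:
  assumes "W \<subseteq> V" "F \<subseteq> E" "\<And>e. e \<in> F \<Longrightarrow> {L e, R e} \<subseteq> W"
  shows "xmonotone_drawing W F L R g"
proof
  show "finite W" "finite F"
    using assms(1,2) finite_V finite_E by (auto intro: finite_subset)
  fix e assume e: "e \<in> F"
  then have "e \<in> E" using assms(2) by blast
  then show "L e $ 1 < R e $ 1" "continuous_on {L e $ 1..R e $ 1} (g e)"
    "g e (L e $ 1) = L e $ 2" "g e (R e $ 1) = R e $ 2"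
    by (fact L_less_R continuous_on_g g_L g_R)+
  show "L e \<in> W" "R e \<in> W" using assms(3)[OF e] by auto
  show "g e (v $ 1) \<noteq> v $ 2" if "v \<in> W" "L e $ 1 < v $ 1" "v $ 1 < R e $ 1" for v
    using \<open>e \<in> E\<close> that assms(1) by (intro vertex_free) auto
  show "e = d" if "d \<in> F" "L e = L d" "R e = R d" for d
    using \<open>e \<in> E\<close> that assms(2) by (intro simple) auto
qed

end

locale plane_xmonotone_drawing = xmonotone_drawing V E L R g
  for V and E :: "'e set" and L R g +
  assumes no_crossing: "e \<in> E \<Longrightarrow> d \<in> E \<Longrightarrow> \<not> crosses e d"
begin

definition below :: "'e \<Rightarrow> 'e \<Rightarrow> bool" where
  "below e d \<longleftrightarrow> (\<exists>x\<in>inner_proj e \<inter> inner_proj d. g e x < g d x)"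

lemma below_imp_less:
  assumes ed: "e \<in> E" "d \<in> E" "below e d" and x: "x \<in> inner_proj e \<inter> inner_proj d"
  shows "g e x < g d x"
proof (rule ccontr)
  assume not_less: "\<not> g e x < g d x"
  define S where "S = inner_proj e \<inter> inner_proj d"
  define h where "h = (\<lambda>z. g d z - g e z)"
  obtain y where y: "y \<in> S" "g e y < g d y" using ed(3) by (auto simp: below_def S_def)
  have "connected S"
    by (simp add: S_def inner_proj_def is_interval_connected_1[symmetric] is_interval_Int)
  moreover have "continuous_on S h" unfolding h_def
    by (intro continuous_intros continuous_on_subset[OF continuous_on_g] ed)
      (auto simp: S_def inner_proj_def)
  ultimately have "connected (h ` S)" by (rule connected_continuous_image[rotated])
  then have "0 \<in> h ` S"
    by (rule connectedD_interval[of _ "h x" "h y"]) (use x y not_less in \<open>auto simp: S_def h_def\<close>)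
  then obtain z where "z \<in> S" "g e z = g d z" by (auto simp: h_def)
  moreover have "e \<noteq> d" using y by auto
  ultimately show False using no_crossing[OF ed(1,2)] by (auto simp: crosses_def S_def)
qed

lemma below_imp_le:
  assumes ed: "e \<in> E" "d \<in> E" "below e d"
    and x: "L e $ 1 \<le> x" "x \<le> R e $ 1" "L d $ 1 \<le> x" "x \<le> R d $ 1"
  shows "g e x \<le> g d x"
proof -
  define l r where "l = max (L e $ 1) (L d $ 1)" and "r = min (R e $ 1) (R d $ 1)"
  have S: "inner_proj e \<inter> inner_proj d = {l<..<r}" by (auto simp: inner_proj_def l_def r_def)
  then have "l < r" using ed(3) by (auto simp: below_def)
  then have closure: "closure {l<..<r} = {l..r}" by (rule closure_greaterThanLessThan)
  have "g e x - g d x \<le> 0"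
  proof (rule continuous_le_on_closure[where f = "\<lambda>z. g e z - g d z"])
    show "continuous_on (closure {l<..<r}) (\<lambda>z. g e z - g d z)" unfolding closure
      by (intro continuous_intros continuous_on_subset[OF continuous_on_g] ed) (auto simp: l_def r_def)
    show "x \<in> closure {l<..<r}" unfolding closure using x by (simp add: l_def r_def)
    show "g e z - g d z \<le> 0" if "z \<in> {l<..<r}" for z
      using below_imp_less[OF ed, of z] that S by auto
  qed
  then show ?thesis by simp
qed

lemma below_total:
  assumes "e \<in> E" "d \<in> E" "e \<noteq> d" "inner_proj e \<inter> inner_proj d \<noteq> {}"
  shows "below e d \<or> below d e"
proof -
  obtain x where x: "x \<in> inner_proj e \<inter> inner_proj d" using assms(4) by blast
  then have "g e x \<noteq> g d x" using no_crossing[OF assms(1,2)] assms(3) by (auto simp: crosses_def)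
  then show ?thesis using x by (auto simp: below_def neq_iff)
qed

definition highest :: "'e set \<Rightarrow> 'e \<Rightarrow> bool" where
  "highest S e \<longleftrightarrow> e \<in> S \<and> (\<forall>d\<in>S. \<not> below e d)"

lemma card_highest_le:
  assumes S: "\<And>v. v \<in> V \<Longrightarrow> S v \<subseteq> E"
    and common: "\<And>v. v \<in> V \<Longrightarrow> \<exists>x. \<forall>e\<in>S v. x \<in> inner_proj e"
  shows "card (\<Union>v\<in>V. {e. highest (S v) e}) \<le> card V"
proof -
  have "card {e. highest (S v) e} \<le> 1" if v: "v \<in> V" for v
  proof -
    have "e = d" if "highest (S v) e" "highest (S v) d" for e d
      using that S[OF v] below_total[of e d] common[OF v] by (auto simp: highest_def)
    moreover have "finite {e. highest (S v) e}"
      using S[OF v] finite_subset[OF _ finite_E] by (auto simp: highest_def)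
    ultimately show ?thesis by (simp add: card_le_Suc0_iff_eq)
  qed
  then have "(\<Sum>v\<in>V. card {e. highest (S v) e}) \<le> (\<Sum>v\<in>V. 1)" by (rule sum_mono)
  then show ?thesis using card_UN_le[OF finite_V, of "\<lambda>v. {e. highest (S v) e}"] by simp
qed

definition leaving :: "real^2 \<Rightarrow> 'e set" where
  "leaving v = {e\<in>E. L e = v}"

definition arriving :: "real^2 \<Rightarrow> 'e set" where
  "arriving v = {e\<in>E. R e = v}"

definition passing_below :: "real^2 \<Rightarrow> 'e set" where
  "passing_below v = {e\<in>E. v $ 1 \<in> inner_proj e \<and> g e (v $ 1) < v $ 2}"

lemma ex_common_inner_leaving: "\<exists>x. \<forall>e\<in>leaving v. x \<in> inner_proj e"
proof -
  have "\<forall>\<^sub>F x in at_right (v $ 1). \<forall>e\<in>leaving v. x \<in> inner_proj e"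
  proof (intro eventually_ball_finite ballI)
    show "\<forall>\<^sub>F x in at_right (v $ 1). x \<in> inner_proj e" if "e \<in> leaving v" for e
      using that L_less_R[of e]
      by (intro eventually_at_rightI[of _ "R e $ 1"]) (auto simp: leaving_def inner_proj_def)
  qed (simp add: leaving_def finite_E)
  then show ?thesis using eventually_happens' trivial_limit_at_right_real by blast
qed

lemma ex_common_inner_arriving: "\<exists>x. \<forall>e\<in>arriving v. x \<in> inner_proj e"
proof -
  have "\<forall>\<^sub>F x in at_left (v $ 1). \<forall>e\<in>arriving v. x \<in> inner_proj e"
  proof (intro eventually_ball_finite ballI)
    show "\<forall>\<^sub>F x in at_left (v $ 1). x \<in> inner_proj e" if "e \<in> arriving v" for e
      using that L_less_R[of e]
      by (intro eventually_at_leftI[of "L e $ 1"]) (auto simp: arriving_def inner_proj_def)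
  qed (simp add: arriving_def finite_E)
  then show ?thesis using eventually_happens' trivial_limit_at_left_real by blast
qed

definition next_above :: "'e \<Rightarrow> 'e \<Rightarrow> bool" where
  "next_above e e' \<longleftrightarrow> e \<in> E \<and> e' \<in> leaving (L e) \<and> below e e' \<and>
     (\<forall>d\<in>leaving (L e). \<not> (below e d \<and> below d e'))"

definition wedge :: "'e \<Rightarrow> 'e \<Rightarrow> (real^2) set" where
  "wedge e e' = {v\<in>V. L e $ 1 < v $ 1 \<and> v $ 1 \<le> R e $ 1 \<and> v $ 1 \<le> R e' $ 1 \<and>
     g e (v $ 1) \<le> v $ 2 \<and> v $ 2 \<le> g e' (v $ 1)}"

lemma next_aboveD:
  assumes "next_above e e'"
  shows "e \<in> E" "e' \<in> E" "L e' = L e" "below e e'"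
  using assms by (auto simp: next_above_def leaving_def)

lemma ex_next_above:
  assumes e: "e \<in> E" and not_highest: "\<not> highest (leaving (L e)) e"
  shows "\<exists>e'. next_above e e'"
proof -
  define A where "A = {d\<in>leaving (L e). below e d}"
  obtain x where x: "\<And>d. d \<in> leaving (L e) \<Longrightarrow> x \<in> inner_proj d"
    using ex_common_inner_leaving by blast
  have A: "finite A" "A \<noteq> {}"
    using not_highest e finite_subset[OF _ finite_E, of A] by (auto simp: A_def leaving_def highest_def)
  define e' where "e' = arg_min_on (\<lambda>d. g d x) A"
  have e': "e' \<in> A" "\<And>d. d \<in> A \<Longrightarrow> g e' x \<le> g d x"
    unfolding e'_def using arg_min_if_finite(1)[OF A] arg_min_least[OF A] by auto
  have "\<not> below d e'" if "d \<in> A" for d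
    using below_imp_less[of d e' x] e' that x by (force simp: A_def leaving_def)
  then have "next_above e e'" using e e'(1) by (auto simp: next_above_def A_def)
  then show ?thesis ..
qed

lemma wedge_nonempty:
  assumes "next_above e e'"
  shows "wedge e e' \<noteq> {}"
proof -
  note e = next_aboveD[OF assms]
  have "R e \<in> wedge e e' \<or> R e' \<in> wedge e e'"
    using below_imp_le[OF e(1,2,4), of "R e $ 1"] below_imp_le[OF e(1,2,4), of "R e' $ 1"] e(3)
      g_R[OF e(1)] g_R[OF e(2)] L_less_R[OF e(1)] L_less_R[OF e(2)] R_in[OF e(1)] R_in[OF e(2)]
    by (cases "R e $ 1 \<le> R e' $ 1") (auto simp: wedge_def)
  then show ?thesis by blast
qed

lemma no_edge_enters_wedge:
  assumes e': "next_above e e'" and d: "d \<in> E" "below e d" "below d e'"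
    and x: "x \<in> inner_proj e \<inter> inner_proj e' \<inter> inner_proj d"
    and empty: "\<And>v. v \<in> wedge e e' \<Longrightarrow> x \<le> v $ 1"
  shows False
proof (cases "L e $ 1 < L d $ 1")
  note e = next_aboveD[OF e']
  case True
  have "L d \<in> wedge e e'"
    using True x L_in[OF d(1)] g_L[OF d(1)] e(3) below_imp_le[OF e(1) d(1,2), of "L d $ 1"]
      below_imp_le[OF d(1) e(2) d(3), of "L d $ 1"] by (auto simp: wedge_def inner_proj_def)
  then show False using empty x by (force simp: inner_proj_def)
next
  note e = next_aboveD[OF e']
  case False
  have "g d (L e $ 1) = L e $ 2"
    using False x g_L[OF e(1)] g_L[OF e(2)] e(3) below_imp_le[OF e(1) d(1,2), of "L e $ 1"]
      below_imp_le[OF d(1) e(2) d(3), of "L e $ 1"] by (auto simp: inner_proj_def)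
  then have "L d = L e"
    using vertex_on_edge[OF d(1) L_in[OF e(1)]] False x by (force simp: inner_proj_def)
  then show False using e' d by (auto simp: next_above_def leaving_def)
qed

definition first_in_wedge :: "'e \<Rightarrow> 'e \<Rightarrow> real^2 \<Rightarrow> bool" where
  "first_in_wedge e e' w \<longleftrightarrow> w \<in> wedge e e' \<and> (\<forall>v\<in>wedge e e'. w $ 1 \<le> v $ 1)"

lemma first_in_wedgeD:
  assumes "first_in_wedge e e' w"
  shows "w \<in> wedge e e'" "w \<in> V" "L e $ 1 < w $ 1" "w $ 1 \<le> R e $ 1" "w $ 1 \<le> R e' $ 1"
    "g e (w $ 1) \<le> w $ 2" "w $ 2 \<le> g e' (w $ 1)"
proof -
  show "w \<in> wedge e e'" using assms by (simp add: first_in_wedge_def)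
  then show "w \<in> V" "L e $ 1 < w $ 1" "w $ 1 \<le> R e $ 1" "w $ 1 \<le> R e' $ 1"
    "g e (w $ 1) \<le> w $ 2" "w $ 2 \<le> g e' (w $ 1)"
    by (simp_all add: wedge_def)
qed

lemma ex_first_in_wedge:
  assumes "next_above e e'"
  shows "\<exists>w. first_in_wedge e e' w"
proof -
  have W: "finite (wedge e e')" "wedge e e' \<noteq> {}"
    using finite_V wedge_nonempty[OF assms] by (simp_all add: wedge_def)
  show ?thesis unfolding first_in_wedge_def
    using arg_min_if_finite(1)[OF W] arg_min_least[OF W, of _ "\<lambda>v. v $ 1"]
    by (intro exI[of _ "arg_min_on (\<lambda>v. v $ 1) (wedge e e')"] conjI ballI)
qed

lemma edge_at_first_in_wedge:
  assumes e': "next_above e e'" and w: "first_in_wedge e e' w"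
    and d: "d \<in> E" "below e d" "L d $ 1 < w $ 1" "w $ 1 \<le> R d $ 1" "g d (w $ 1) \<le> w $ 2"
  shows "g d (w $ 1) = w $ 2" "g e' (w $ 1) = w $ 2"
proof -
  note e = next_aboveD[OF e']
  note wD = first_in_wedgeD[OF w]
  obtain x where x: "max (L e $ 1) (L d $ 1) < x" "x < w $ 1"
    using dense[of "max (L e $ 1) (L d $ 1)" "w $ 1"] d(3) wD(3) by auto
  then have inner: "x \<in> inner_proj e \<inter> inner_proj e' \<inter> inner_proj d"
    using wD(4,5) d(4) e(3) by (auto simp: inner_proj_def)
  have "x \<le> v $ 1" if "v \<in> wedge e e'" for v
    using w that x(2) by (force simp: first_in_wedge_def)
  then have "\<not> below d e'"
    using no_edge_enters_wedge[OF e' d(1,2) _ inner] by blast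
  then have "d = e' \<or> below e' d" using below_total[OF d(1) e(2)] inner by auto
  then have "g e' (w $ 1) \<le> g d (w $ 1)"
    using below_imp_le[OF e(2) d(1), of "w $ 1"] wD(3,5) d(3,4) e(3) by auto
  then show "g d (w $ 1) = w $ 2" "g e' (w $ 1) = w $ 2" using wD(7) d(5) by linarith+
qed

lemma highest_arriving_if_first_in_wedge:
  assumes e': "next_above e e'" and w: "first_in_wedge e e' w" and w_end: "w $ 1 = R e $ 1"
  shows "highest (arriving (R e)) e"
proof -
  note e = next_aboveD[OF e']
  have "R e $ 1 \<le> R e' $ 1" using first_in_wedgeD(5)[OF w] w_end by simp
  then have "R e \<in> wedge e e'"
    using below_imp_le[OF e(1,2,4), of "R e $ 1"] L_less_R[OF e(1)] R_in[OF e(1)] g_R[OF e(1)] e(3)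
    by (simp add: wedge_def)
  then have first: "first_in_wedge e e' (R e)" using w by (simp add: first_in_wedge_def w_end)
  have "\<not> below e d" if d: "d \<in> arriving (R e)" for d
  proof
    assume "below e d"
    have dE: "d \<in> E" "R d = R e" using d by (simp_all add: arriving_def)
    then have "g e' (R e $ 1) = R e $ 2"
      using L_less_R[OF dE(1)] g_R[OF dE(1)]
      by (intro edge_at_first_in_wedge(2)[OF e' first dE(1) \<open>below e d\<close>]) (simp_all add: dE(2))
    then have "R e = L e' \<or> R e = R e'"
      using \<open>R e $ 1 \<le> R e' $ 1\<close> L_less_R[OF e(1)]
      by (intro vertex_on_edge[OF e(2) R_in[OF e(1)]]) (simp_all add: e(3))
    moreover have "R e \<noteq> L e'" using L_less_R[OF e(1)] e(3) by auto
    ultimately have "e = e'" by (intro simple[OF e(1,2)]) (simp_all add: e(3))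
    then show False using e(4) by (simp add: below_def)
  qed
  then show ?thesis using e(1) by (simp add: highest_def arriving_def)
qed

lemma highest_passing_below_if_first_in_wedge:
  assumes e': "next_above e e'" and w: "first_in_wedge e e' w" and w_inner: "w $ 1 \<noteq> R e $ 1"
  shows "highest (passing_below w) e"
proof -
  note e = next_aboveD(1)[OF e']
  note wD = first_in_wedgeD[OF w]
  have "e \<in> passing_below w"
    using vertex_free[OF e wD(2)] wD(3,4,6) w_inner e by (simp add: passing_below_def inner_proj_def)
  moreover have "\<not> below e d" if "d \<in> passing_below w" for d
    using edge_at_first_in_wedge(1)[OF e' w, of d] that
    by (fastforce simp: passing_below_def inner_proj_def)
  ultimately show ?thesis by (simp add: highest_def)
qed

lemma highest_in_some_family:
  assumes "e \<in> E"
  shows "highest (leaving (L e)) e \<or> highest (arriving (R e)) e \<or>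
    (\<exists>v\<in>V. highest (passing_below v) e)"
proof (cases "highest (leaving (L e)) e")
  case False
  then obtain e' w where "next_above e e'" "first_in_wedge e e' w"
    using ex_next_above[OF assms] ex_first_in_wedge by blast
  then show ?thesis
    using highest_arriving_if_first_in_wedge highest_passing_below_if_first_in_wedge first_in_wedgeD(2)
    by metis
qed simp

theorem card_edges_le: "card E \<le> 3 * card V"
proof -
  let ?H = "\<lambda>S. \<Union>v\<in>V. {e. highest (S v) e}"
  have "card (?H leaving) \<le> card V"
    by (rule card_highest_le[OF _ ex_common_inner_leaving]) (auto simp: leaving_def)
  moreover have "card (?H arriving) \<le> card V"
    by (rule card_highest_le[OF _ ex_common_inner_arriving]) (auto simp: arriving_def)
  moreover have "card (?H passing_below) \<le> card V"
    by (rule card_highest_le) (auto simp: passing_below_def)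
  moreover have "card E \<le> card (?H leaving \<union> ?H arriving \<union> ?H passing_below)"
  proof (rule card_mono)
    show "finite (?H leaving \<union> ?H arriving \<union> ?H passing_below)"
      by (rule finite_subset[OF _ finite_E])
        (auto simp: highest_def leaving_def arriving_def passing_below_def)
    show "E \<subseteq> ?H leaving \<union> ?H arriving \<union> ?H passing_below"
    proof
      show "e \<in> ?H leaving \<union> ?H arriving \<union> ?H passing_below" if "e \<in> E" for e
        using highest_in_some_family[OF that] L_in[OF that] R_in[OF that] by blast
    qed
  qed
  moreover have "\<dots> \<le> card (?H leaving) + card (?H arriving) + card (?H passing_below)"
    by (meson add_right_mono card_Un_le order_trans)
  ultimately show ?thesis by linarith
qed

end

section \<open>The crossing lemma\<close>

lemma card_PiE_constant_on:
  assumes "finite V" "T \<subseteq> V" "c \<in> C"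
  shows "card {f \<in> V \<rightarrow>\<^sub>E C. T \<subseteq> {v\<in>V. f v = c}} * card C ^ card T = card C ^ card V"
proof -
  have "{f \<in> V \<rightarrow>\<^sub>E C. T \<subseteq> {v\<in>V. f v = c}} = (\<Pi>\<^sub>E v\<in>V. if v \<in> T then {c} else C)"
    using assms(2,3) unfolding set_eq_iff PiE_iff by (fastforce split: if_splits)
  then have "card {f \<in> V \<rightarrow>\<^sub>E C. T \<subseteq> {v\<in>V. f v = c}} = (\<Prod>v\<in>V. if v \<in> T then 1 else card C)"
    using assms(1) by (auto simp: card_PiE intro!: prod.cong)
  also have "\<dots> = card C ^ card (V - T)"
    using assms(1,2) by (subst prod.mono_neutral_cong_right[of V "V - T" _ "\<lambda>_. card C"]) auto
  finally show ?thesis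
    using assms finite_subset[of T V] by (simp add: card_Diff_subset card_mono flip: power_add)
qed

lemma sum_card_sampled:
  assumes V: "finite V" and C: "finite C" "c \<in> C" and A: "finite A"
    and T: "\<And>a. a \<in> A \<Longrightarrow> T a \<subseteq> V \<and> card (T a) = j"
  shows "(\<Sum>f\<in>V \<rightarrow>\<^sub>E C. card {a\<in>A. T a \<subseteq> {v\<in>V. f v = c}}) * card C ^ j = card A * card C ^ card V"
proof -
  have "finite (V \<rightarrow>\<^sub>E C)" using V C by (intro finite_PiE) auto
  then have "(\<Sum>f\<in>V \<rightarrow>\<^sub>E C. card {a\<in>A. T a \<subseteq> {v\<in>V. f v = c}})
      = (\<Sum>a\<in>A. card {f \<in> V \<rightarrow>\<^sub>E C. T a \<subseteq> {v\<in>V. f v = c}})"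
    using A by (intro sum_multicount_gen[where R = "\<lambda>f a. T a \<subseteq> {v\<in>V. f v = c}"]) simp_all
  then have "(\<Sum>f\<in>V \<rightarrow>\<^sub>E C. card {a\<in>A. T a \<subseteq> {v\<in>V. f v = c}}) * card C ^ j
      = (\<Sum>a\<in>A. card {f \<in> V \<rightarrow>\<^sub>E C. T a \<subseteq> {v\<in>V. f v = c}} * card C ^ card (T a))"
    using T by (simp add: sum_distrib_right)
  also have "\<dots> = (\<Sum>a\<in>A. card C ^ card V)"
    using T V C by (intro sum.cong refl card_PiE_constant_on) auto
  finally show ?thesis by simp
qed

context xmonotone_drawing
begin

lemma card_edges_le_add_crossings: "card E \<le> 3 * card V + card crossings"
proof -
  interpret plane: plane_xmonotone_drawing V "E - fst ` crossings" L R g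
  proof (intro plane_xmonotone_drawing.intro plane_xmonotone_drawing_axioms.intro)
    show "xmonotone_drawing V (E - fst ` crossings) L R g"
      using L_in R_in by (intro subdrawing) auto
    show "\<not> crosses e d" if "e \<in> E - fst ` crossings" "d \<in> E - fst ` crossings" for e d
      using that by (force simp: crossings_def)
  qed
  have "card E \<le> card (E - fst ` crossings) + card (fst ` crossings)"
    using diff_card_le_card_Diff[of "fst ` crossings" E] finite_crossings by simp
  also have "card (fst ` crossings) \<le> card crossings" using finite_crossings by (rule card_image_le)
  finally show ?thesis using plane.card_edges_le by linarith
qed

definition ends :: "'e \<Rightarrow> (real^2) set" where
  "ends e = {L e, R e}"

definition crossing_ends :: "'e \<times> 'e \<Rightarrow> (real^2) set" where
  "crossing_ends = (\<lambda>(e, d). ends e \<union> ends d)"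

lemma card_ends: "e \<in> E \<Longrightarrow> ends e \<subseteq> V \<and> card (ends e) = 2"
  using L_in R_in L_less_R[of e] by (cases "L e = R e") (auto simp: ends_def)

lemma card_crossing_ends:
  assumes p: "p \<in> crossings" and disjoint: "\<And>e d. (e, d) \<in> crossings \<Longrightarrow> ends e \<inter> ends d = {}"
  shows "crossing_ends p \<subseteq> V \<and> card (crossing_ends p) = 4"
proof -
  obtain e d where ed: "p = (e, d)" "e \<in> E" "d \<in> E" using p by (auto simp: crossings_def)
  have "card (ends e \<union> ends d) = card (ends e) + card (ends d)"
    using disjoint[of e d] p by (intro card_Un_disjoint) (auto simp: ed ends_def)
  then show ?thesis using card_ends[OF ed(2)] card_ends[OF ed(3)] by (simp add: ed crossing_ends_def)
qed

lemma card_induced_edges_le: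
  assumes "W \<subseteq> V"
  shows "card {e\<in>E. ends e \<subseteq> W} \<le> 3 * card W + card {p\<in>crossings. crossing_ends p \<subseteq> W}"
proof -
  interpret induced: xmonotone_drawing W "{e\<in>E. ends e \<subseteq> W}" L R g
    using assms by (intro subdrawing) (auto simp: ends_def)
  have "induced.crossings = {p\<in>crossings. crossing_ends p \<subseteq> W}"
    unfolding induced.crossings_def crossings_def crossing_ends_def by auto
  then show ?thesis using induced.card_edges_le_add_crossings by simp
qed

text \<open>
  Colour the vertices independently with \<open>s\<close> colours and keep those of colour \<open>0\<close>: a vertex, an edge
  and a crossing survive with probability \<open>1/s\<close>, \<open>1/s\<^sup>2\<close> and \<open>1/s\<^sup>4\<close>. Probabilities are
  multiplied by the number \<open>N\<close> of colourings.
\<close>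

lemma card_edges_sampled_le:
  assumes disjoint: "\<And>e d. (e, d) \<in> crossings \<Longrightarrow> ends e \<inter> ends d = {}" and s: "s > 0"
  shows "card E * s ^ 2 \<le> 3 * card V * s ^ 3 + card crossings"
proof -
  define W where "W f = {v\<in>V. f v = (0::nat)}" for f
  define N where "N = s ^ card V"
  let ?F = "V \<rightarrow>\<^sub>E {..<s}"
  let ?e = "\<Sum>f\<in>?F. card {e\<in>E. ends e \<subseteq> W f}"
  let ?v = "\<Sum>f\<in>?F. card {v\<in>V. {v} \<subseteq> W f}"
  let ?x = "\<Sum>f\<in>?F. card {p\<in>crossings. crossing_ends p \<subseteq> W f}"
  note sampled = sum_card_sampled[OF finite_V finite_lessThan, of 0 s, unfolded card_lessThan,
      folded W_def N_def]
  have edges: "?e * s ^ 2 = card E * N"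
    using s by (intro sampled finite_E card_ends) simp_all
  have vertices: "?v * s ^ 1 = card V * N"
    using s by (intro sampled finite_V) simp_all
  have crosses: "?x * s ^ 4 = card crossings * N"
    using s by (intro sampled finite_crossings card_crossing_ends disjoint) simp_all
  have "card {e\<in>E. ends e \<subseteq> W f} \<le>
      3 * card {v\<in>V. {v} \<subseteq> W f} + card {p\<in>crossings. crossing_ends p \<subseteq> W f}" for f
  proof -
    have "W f \<subseteq> V" "{v\<in>V. {v} \<subseteq> W f} = W f" by (auto simp: W_def)
    then show ?thesis using card_induced_edges_le[of "W f"] by simp
  qed
  then have "?e \<le> (\<Sum>f\<in>?F. 3 * card {v\<in>V. {v} \<subseteq> W f} + card {p\<in>crossings. crossing_ends p \<subseteq> W f})"
    by (intro sum_mono)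
  also have "\<dots> = 3 * ?v + ?x" by (simp add: sum.distrib sum_distrib_left)
  finally have "?e * s ^ 4 \<le> (3 * ?v + ?x) * s ^ 4" by (rule mult_right_mono) simp
  then have "(?e * s ^ 2) * s ^ 2 \<le> 3 * (?v * s ^ 1) * s ^ 3 + ?x * s ^ 4"
    by (simp add: algebra_simps power_numeral_reduce)
  then have "(card E * s ^ 2) * N \<le> (3 * card V * s ^ 3 + card crossings) * N"
    unfolding edges vertices crosses by (simp add: algebra_simps)
  then show ?thesis using s by (simp add: N_def)
qed

theorem crossing_lemma:
  assumes disjoint: "\<And>e d. (e, d) \<in> crossings \<Longrightarrow> ends e \<inter> ends d = {}"
    and many_edges: "6 * card V < card E"
  shows "card E ^ 3 \<le> 288 * card V ^ 2 * card crossings"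
proof -
  have "E \<noteq> {}" using many_edges by auto
  then have V_pos: "card V > 0" using L_in finite_V by (auto simp: card_gt_0_iff)
  define s where "s = card E div (6 * card V)"
  have s: "s > 0" using many_edges V_pos by (simp add: s_def div_greater_zero_iff)
  have lower: "6 * card V * s \<le> card E" by (simp add: s_def)
  have "card E < 6 * card V * (s + 1)"
    using dividend_less_times_div[of "6 * card V" "card E"] V_pos by (simp add: s_def algebra_simps)
  also have "\<dots> \<le> 12 * card V * s" using s by (cases s) auto
  finally have upper: "card E \<le> 12 * card V * s" by simp
  have "6 * card V * s * s ^ 2 \<le> card E * s ^ 2" using lower by (rule mult_right_mono) simp
  moreover have "6 * card V * s * s ^ 2 = 2 * (3 * card V * s ^ 3)" by (simp add: power_numeral_reduce)
  ultimately have sampled: "card E * s ^ 2 \<le> 2 * card crossings"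
    using card_edges_sampled_le[OF disjoint s] by linarith
  have "card E ^ 3 = card E * card E ^ 2" by (simp add: power_numeral_reduce)
  also have "\<dots> \<le> card E * (12 * card V * s) ^ 2" using upper by (intro mult_left_mono power_mono) auto
  also have "\<dots> = 144 * card V ^ 2 * (card E * s ^ 2)" by (simp add: power_mult_distrib algebra_simps)
  also have "\<dots> \<le> 144 * card V ^ 2 * (2 * card crossings)" using sampled by (rule mult_left_mono) simp
  finally show ?thesis by simp
qed

end

section \<open>Incidences with pseudo-segments\<close>

locale pseudo_segments =
  fixes P :: "(real^2) set" and Q :: "'q set" and lo hi :: "'q \<Rightarrow> real" and g :: "'q \<Rightarrow> real \<Rightarrow> real"
  assumes finite_P: "finite P" and finite_Q: "finite Q"
    and continuous_on_curve: "q \<in> Q \<Longrightarrow> continuous_on {lo q..hi q} (g q)"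
    and meet_once: "q \<in> Q \<Longrightarrow> q' \<in> Q \<Longrightarrow> q \<noteq> q' \<Longrightarrow>
      x \<in> {lo q..hi q} \<inter> {lo q'..hi q'} \<Longrightarrow> x' \<in> {lo q..hi q} \<inter> {lo q'..hi q'} \<Longrightarrow>
      g q x = g q' x \<Longrightarrow> g q x' = g q' x' \<Longrightarrow> x = x'"
begin

definition points_on :: "'q \<Rightarrow> (real^2) set" where
  "points_on q = {p\<in>P. p $ 1 \<in> {lo q..hi q} \<and> g q (p $ 1) = p $ 2}"

definition incidences :: "('q \<times> (real^2)) set" where
  "incidences = (SIGMA q:Q. points_on q)"

text \<open>An arc between consecutive points of a curve is represented by the curve and its left endpoint.\<close>

definition arcs :: "('q \<times> (real^2)) set" where
  "arcs = {(q, p)\<in>incidences. \<exists>p'\<in>points_on q. p $ 1 < p' $ 1}"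

definition right_end :: "'q \<times> (real^2) \<Rightarrow> real^2" where
  "right_end e = arg_min_on (\<lambda>p. p $ 1) {p\<in>points_on (fst e). snd e $ 1 < p $ 1}"

lemma finite_points_on: "finite (points_on q)"
  using finite_P by (simp add: points_on_def)

lemma points_on_eqI: "p \<in> points_on q \<Longrightarrow> r \<in> points_on q \<Longrightarrow> p $ 1 = r $ 1 \<Longrightarrow> p = r"
  by (auto simp: points_on_def intro!: vec2_eqI)

lemma finite_incidences: "finite incidences"
  by (simp add: incidences_def finite_Q finite_points_on)

lemma arcs_subset: "arcs \<subseteq> incidences"
  by (auto simp: arcs_def)

lemma finite_arcs: "finite arcs"
  using finite_subset[OF arcs_subset finite_incidences] .

lemma arcD:
  assumes "e \<in> arcs"
  shows "fst e \<in> Q" "snd e \<in> points_on (fst e)" "right_end e \<in> points_on (fst e)"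
    "snd e $ 1 < right_end e $ 1"
    "\<And>r. r \<in> points_on (fst e) \<Longrightarrow> snd e $ 1 < r $ 1 \<Longrightarrow> right_end e $ 1 \<le> r $ 1"
proof -
  let ?S = "{p\<in>points_on (fst e). snd e $ 1 < p $ 1}"
  have S: "finite ?S" "?S \<noteq> {}" using assms finite_points_on by (auto simp: arcs_def)
  show "right_end e \<in> points_on (fst e)" "snd e $ 1 < right_end e $ 1"
    using arg_min_if_finite(1)[OF S, of "\<lambda>p. p $ 1"] by (auto simp: right_end_def)
  show "right_end e $ 1 \<le> r $ 1" if "r \<in> points_on (fst e)" "snd e $ 1 < r $ 1" for r
    using arg_min_least[OF S, of r "\<lambda>p. p $ 1"] that by (simp add: right_end_def)
  show "fst e \<in> Q" "snd e \<in> points_on (fst e)" using assms by (auto simp: arcs_def incidences_def)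
qed

lemma arc_domain: "e \<in> arcs \<Longrightarrow> {snd e $ 1..right_end e $ 1} \<subseteq> {lo (fst e)..hi (fst e)}"
  using arcD(2,3)[of e] by (auto simp: points_on_def)

lemma meet_once_points_on:
  assumes "q \<in> Q" "q' \<in> Q" "q \<noteq> q'"
    and "p \<in> points_on q" "p \<in> points_on q'" and "x \<in> {lo q..hi q} \<inter> {lo q'..hi q'}" "g q x = g q' x"
  shows "p $ 1 = x"
  using assms by (intro meet_once[of q q' "p $ 1" x]) (auto simp: points_on_def)

sublocale arcs: xmonotone_drawing P arcs snd right_end "\<lambda>e. g (fst e)"
proof
  show "finite P" "finite arcs" by (rule finite_P finite_arcs)+
  fix e assume e: "e \<in> arcs"
  show "snd e \<in> P" "right_end e \<in> P" "snd e $ 1 < right_end e $ 1"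
    "g (fst e) (snd e $ 1) = snd e $ 2" "g (fst e) (right_end e $ 1) = right_end e $ 2"
    using arcD(2-4)[OF e] by (auto simp: points_on_def)
  show "continuous_on {snd e $ 1..right_end e $ 1} (g (fst e))"
    by (rule continuous_on_subset[OF continuous_on_curve[OF arcD(1)[OF e]] arc_domain[OF e]])
  show "g (fst e) (v $ 1) \<noteq> v $ 2" if "v \<in> P" "snd e $ 1 < v $ 1" "v $ 1 < right_end e $ 1" for v
  proof
    assume "g (fst e) (v $ 1) = v $ 2"
    then have "v \<in> points_on (fst e)"
      using arc_domain[OF e] that by (auto simp: points_on_def subset_iff)
    then show False using arcD(5)[OF e, of v] that by simp
  qed
  fix d assume d: "d \<in> arcs" and eq: "snd e = snd d" "right_end e = right_end d"
  have "fst e = fst d"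
  proof (rule ccontr)
    assume neq: "fst e \<noteq> fst d"
    have "snd e \<in> points_on (fst d)" "right_end e \<in> points_on (fst d)"
      unfolding eq by (rule arcD[OF d])+
    then have "snd e $ 1 = right_end e $ 1"
      using arcD(1-3)[OF e] arcD(1)[OF d]
      by (intro meet_once_points_on[OF _ _ neq]) (simp_all add: points_on_def)
    then show False using arcD(4)[OF e] by simp
  qed
  then show "e = d" using eq by (simp add: prod_eqI)
qed

lemma overlapping_arcs_of_curve_eq:
  assumes e: "e \<in> arcs" and d: "d \<in> arcs" and curve: "fst e = fst d"
    and x: "x \<in> arcs.inner_proj e \<inter> arcs.inner_proj d"
  shows "e = d"
proof -
  have "snd d \<in> points_on (fst e)" "snd e \<in> points_on (fst d)"
    using arcD(2)[OF e] arcD(2)[OF d] curve by simp_all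
  moreover from this have "snd e $ 1 = snd d $ 1"
    using arcD(5)[OF e, of "snd d"] arcD(5)[OF d, of "snd e"] x by (force simp: arcs.inner_proj_def)
  ultimately show ?thesis
    using points_on_eqI[OF arcD(2)[OF e]] curve by (simp add: prod_eqI)
qed

lemma crossingE:
  assumes "(e, d) \<in> arcs.crossings"
  obtains x where "e \<in> arcs" "d \<in> arcs" "fst e \<noteq> fst d"
    "x \<in> arcs.inner_proj e \<inter> arcs.inner_proj d" "g (fst e) x = g (fst d) x"
  using assms overlapping_arcs_of_curve_eq[of e d]
  by (auto simp: arcs.crossings_def arcs.crosses_def)

lemma inner_proj_Int_subset:
  assumes "e \<in> arcs" "d \<in> arcs"
  shows "arcs.inner_proj e \<inter> arcs.inner_proj d \<subseteq> {lo (fst e)..hi (fst e)} \<inter> {lo (fst d)..hi (fst d)}"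
  using assms[THEN arc_domain] by (auto simp: arcs.inner_proj_def subset_iff)

lemma crossing_arcs_share_no_endpoint:
  assumes "(e, d) \<in> arcs.crossings"
  shows "arcs.ends e \<inter> arcs.ends d = {}"
proof (rule ccontr)
  assume "arcs.ends e \<inter> arcs.ends d \<noteq> {}"
  then obtain v where v: "v \<in> {snd e, right_end e}" "v \<in> {snd d, right_end d}"
    unfolding arcs.ends_def by blast
  obtain x where x: "e \<in> arcs" "d \<in> arcs" "fst e \<noteq> fst d"
    "x \<in> arcs.inner_proj e \<inter> arcs.inner_proj d" "g (fst e) x = g (fst d) x"
    using crossingE[OF assms] .
  have "v \<in> points_on (fst e)" "v \<in> points_on (fst d)"
    using v arcD(2,3)[OF x(1)] arcD(2,3)[OF x(2)] by auto
  then have "v $ 1 = x"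
    using inner_proj_Int_subset[OF x(1,2)] x(4,5) arcD(1)[OF x(1)] arcD(1)[OF x(2)]
    by (intro meet_once_points_on[OF _ _ x(3)]) blast+
  then show False using v(1) x(4) by (auto simp: arcs.inner_proj_def)
qed

lemma card_crossings_le: "card arcs.crossings \<le> card Q ^ 2"
proof -
  have "inj_on (map_prod fst fst) arcs.crossings"
  proof (rule inj_onI, clarify)
    fix e d e' d'
    assume crossing: "(e, d) \<in> arcs.crossings" "(e', d') \<in> arcs.crossings"
    assume "map_prod fst fst (e, d) = map_prod fst fst (e', d')"
    then have curves: "fst e = fst e'" "fst d = fst d'" by simp_all
    obtain x where x: "e \<in> arcs" "d \<in> arcs" "fst e \<noteq> fst d"
      "x \<in> arcs.inner_proj e \<inter> arcs.inner_proj d" "g (fst e) x = g (fst d) x"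
      using crossingE[OF crossing(1)] .
    obtain y where y: "e' \<in> arcs" "d' \<in> arcs" "fst e' \<noteq> fst d'"
      "y \<in> arcs.inner_proj e' \<inter> arcs.inner_proj d'" "g (fst e') y = g (fst d') y"
      using crossingE[OF crossing(2)] .
    have "x = y"
    proof (rule meet_once[OF arcD(1)[OF x(1)] arcD(1)[OF x(2)] x(3)])
      show "x \<in> {lo (fst e)..hi (fst e)} \<inter> {lo (fst d)..hi (fst d)}"
        using inner_proj_Int_subset[OF x(1,2)] x(4) by (rule subsetD)
      show "y \<in> {lo (fst e)..hi (fst e)} \<inter> {lo (fst d)..hi (fst d)}"
        unfolding curves using inner_proj_Int_subset[OF y(1,2)] y(4) by (rule subsetD)
    qed (use x(5) y(5) curves in simp_all)
    then have "x \<in> arcs.inner_proj e \<inter> arcs.inner_proj e'" "x \<in> arcs.inner_proj d \<inter> arcs.inner_proj d'"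
      using x(4) y(4) by simp_all
    then show "e = e' \<and> d = d'"
      using overlapping_arcs_of_curve_eq[OF x(1) y(1) curves(1)]
        overlapping_arcs_of_curve_eq[OF x(2) y(2) curves(2)] by simp
  qed
  then have "card arcs.crossings \<le> card (Q \<times> Q)"
    by (rule card_inj_on_le) (use arcD(1) finite_Q in \<open>force simp: arcs.crossings_def\<close>)+
  then show ?thesis by (simp add: card_cartesian_product power2_eq_square)
qed

lemma card_incidences_le_add_arcs: "card incidences \<le> card Q + card arcs"
proof -
  have "inj_on fst (incidences - arcs)"
  proof (rule inj_onI)
    fix a b assume a: "a \<in> incidences - arcs" and b: "b \<in> incidences - arcs" and eq: "fst a = fst b"
    then have "snd a \<in> points_on (fst a)" "snd b \<in> points_on (fst a)" by (auto simp: incidences_def)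
    moreover have "\<not> snd a $ 1 < snd b $ 1" "\<not> snd b $ 1 < snd a $ 1"
      using a b eq by (auto simp: incidences_def arcs_def)
    ultimately have "snd a = snd b" by (intro points_on_eqI) auto
    with eq show "a = b" by (rule prod_eqI)
  qed
  then have "card (incidences - arcs) \<le> card Q"
    by (rule card_inj_on_le) (auto simp: incidences_def finite_Q)
  then show ?thesis
    using card_Diff_subset[OF finite_arcs arcs_subset] card_mono[OF finite_incidences arcs_subset] by simp
qed

theorem card_incidences_le:
  "real (card incidences) \<le>
     7 * (real (card P) * real (card Q)) powr (2/3) + 6 * real (card P) + real (card Q)"
proof (cases "card arcs \<le> 6 * card P")
  case True
  then show ?thesis
    using card_incidences_le_add_arcs powr_ge_zero[of "real (card P) * real (card Q)" "2/3"] by linarith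
next
  case False
  define m where "m = real (card P) * real (card Q)"
  have "card arcs ^ 3 \<le> 288 * card P ^ 2 * card arcs.crossings"
    using False by (intro arcs.crossing_lemma[OF crossing_arcs_share_no_endpoint]) simp_all
  also have "\<dots> \<le> 288 * card P ^ 2 * card Q ^ 2" using card_crossings_le by (rule mult_left_mono) simp
  also have "\<dots> \<le> 7 ^ 3 * (card P * card Q) ^ 2" by (simp add: power_mult_distrib)
  finally have "real (card arcs ^ 3) \<le> real (7 ^ 3 * (card P * card Q) ^ 2)" by (rule of_nat_mono)
  also have "\<dots> = (7 * m powr (2/3)) ^ 3"
    by (cases "m = 0") (auto simp: m_def power_mult_distrib powr_power powr_numeral)
  finally have "real (card arcs) \<le> 7 * m powr (2/3)"
    unfolding of_nat_power by (rule power_le_imp_le_base[of _ 2, simplified]) simp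
  then show ?thesis using card_incidences_le_add_arcs by (simp add: m_def)
qed

end

section \<open>Circles of equal radius\<close>

lemma sphere_Int_sphere_subset_pair:
  fixes a b :: "'a::euclidean_space"
  assumes dim: "DIM('a) = 2" and "a \<noteq> b"
  shows "\<exists>u v. sphere a r \<inter> sphere b t \<subseteq> {u, v}"
proof (cases "sphere a r \<inter> sphere b t = {}")
  case False
  then obtain u where "u \<in> sphere a r \<inter> sphere b t" by blast
  then have u: "dist a u = r" "dist b u = t" by simp_all
  have "dim {x. (b - a) \<bullet> x = 0} = 1" using dim_hyperplane[of "b - a"] assms by simp
  then obtain w where w: "{x. (b - a) \<bullet> x = 0} \<subseteq> span {w}"
    by (metis basis_exists card_1_singletonE)
  define s where "s = - (2 * (w \<bullet> (u - a))) / (w \<bullet> w)"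
  have s: "w \<noteq> 0 \<Longrightarrow> s * (w \<bullet> w) = - (2 * (w \<bullet> (u - a)))" by (simp add: s_def)
  have "sphere a r \<inter> sphere b t \<subseteq> {u, u + s *\<^sub>R w}"
  proof
    fix z assume "z \<in> sphere a r \<inter> sphere b t"
    then have z: "dist a z = r" "dist b z = t" by simp_all
    have norms: "(z - a) \<bullet> (z - a) = (u - a) \<bullet> (u - a)" "(z - b) \<bullet> (z - b) = (u - b) \<bullet> (u - b)"
      using u z by (simp_all flip: power2_norm_eq_inner add: dist_norm norm_minus_commute)
    then have "(b - a) \<bullet> (z - u) = 0" by (simp add: inner_diff_left inner_diff_right inner_commute)
    then obtain c where "z - u = c *\<^sub>R w" using w by (auto simp: span_singleton)
    then have c: "z = u + c *\<^sub>R w" by (simp add: algebra_simps)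
    then have "c * (c * (w \<bullet> w) + 2 * (w \<bullet> (u - a))) = 0"
      using norms(1)
      by (simp add: inner_diff_left inner_diff_right inner_add_left inner_add_right inner_commute
          algebra_simps)
    then have "c = 0 \<or> c * (w \<bullet> w) = - (2 * (w \<bullet> (u - a)))" by (simp add: eq_neg_iff_add_eq_0)
    then have "w = 0 \<or> c = 0 \<or> c = s" using s by (metis mult_right_cancel inner_eq_zero_iff)
    then show "z \<in> {u, u + s *\<^sub>R w}" by (auto simp: c)
  qed
  then show ?thesis by blast
qed simp

corollary
  fixes a b :: "'a::euclidean_space"
  assumes "DIM('a) = 2" "a \<noteq> b"
  shows finite_sphere_Int_sphere: "finite (sphere a r \<inter> sphere b t)"
    and card_sphere_Int_sphere_le: "card (sphere a r \<inter> sphere b t) \<le> 2"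
proof -
  obtain u v where subset: "sphere a r \<inter> sphere b t \<subseteq> {u, v}"
    using sphere_Int_sphere_subset_pair[OF assms] by blast
  then show "finite (sphere a r \<inter> sphere b t)" by (rule finite_subset) simp
  have "card (sphere a r \<inter> sphere b t) \<le> card {u, v}" using subset by (intro card_mono) simp_all
  also have "\<dots> \<le> 2" by (simp add: card_insert_if)
  finally show "card (sphere a r \<inter> sphere b t) \<le> 2" .
qed

text \<open>
  The circles of radius \<open>\<delta>\<close> around \<open>p\<close> and \<open>p'\<close> have at most two common points, and the reflection
  at the midpoint of \<open>p\<close> and \<open>p'\<close> permutes them.
\<close>

lemma centre_eq_or_reflected:
  fixes p p' q q' :: "'a::euclidean_space"
  assumes dim: "DIM('a) = 2" and "p \<noteq> p'" and q: "dist q p = \<delta>" "dist q p' = \<delta>"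
    and q': "dist q' p = \<delta>" "dist q' p' = \<delta>"
  shows "q' = q \<or> q' = p + p' - q"
proof (rule ccontr)
  assume neither: "\<not> (q' = q \<or> q' = p + p' - q)"
  have card_le: "card S \<le> 2" if "S \<subseteq> sphere p \<delta> \<inter> sphere p' \<delta>" for S
    using card_mono[OF finite_sphere_Int_sphere[OF assms(1,2)] that]
      card_sphere_Int_sphere_le[OF assms(1,2), of \<delta> \<delta>] by linarith
  have reflected: "p + p' - c \<in> sphere p \<delta> \<inter> sphere p' \<delta>" if "c \<in> sphere p \<delta> \<inter> sphere p' \<delta>" for c
    using that by (simp add: dist_norm norm_minus_commute)
  have mem: "q \<in> sphere p \<delta> \<inter> sphere p' \<delta>" "q' \<in> sphere p \<delta> \<inter> sphere p' \<delta>"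
    using q q' by (simp_all add: dist_commute)
  have "card {q, q', p + p' - q} \<le> 2" "card {q, q', p + p' - q'} \<le> 2"
    by (intro card_le insert_subsetI empty_subsetI mem reflected)+
  then have "q = p + p' - q" "q' = p + p' - q'"
    using neither by (auto simp: card_insert_if algebra_simps split: if_splits)
  then have "2 *\<^sub>R q = 2 *\<^sub>R q'" by (simp add: scaleR_2 algebra_simps)
  then show False using neither by simp
qed

definition semicircle :: "real \<Rightarrow> real \<Rightarrow> real^2 \<Rightarrow> (real^2) set" where
  "semicircle \<sigma> \<delta> q = {p. dist q p = \<delta> \<and> 0 \<le> \<sigma> * (p $ 2 - q $ 2)}"

definition semicircle_height :: "real \<Rightarrow> real \<Rightarrow> real^2 \<Rightarrow> real \<Rightarrow> real" where
  "semicircle_height \<sigma> \<delta> q x = q $ 2 + \<sigma> * sqrt (\<delta>\<^sup>2 - (x - q $ 1)\<^sup>2)"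

lemma dist_vec2_eq_iff:
  fixes p q :: "real^2"
  shows "dist q p = \<delta> \<longleftrightarrow> 0 \<le> \<delta> \<and> (p $ 1 - q $ 1)\<^sup>2 + (p $ 2 - q $ 2)\<^sup>2 = \<delta>\<^sup>2"
proof -
  have "dist q p = sqrt ((p $ 1 - q $ 1)\<^sup>2 + (p $ 2 - q $ 2)\<^sup>2)"
    by (simp add: dist_vec_def L2_set_def UNIV_2 dist_real_def power2_commute)
  then show ?thesis by (auto simp: real_sqrt_unique)
qed

lemma mem_semicircle_iff:
  assumes \<sigma>: "\<sigma> \<in> {1, -1}"
  shows "p \<in> semicircle \<sigma> \<delta> q \<longleftrightarrow>
    p $ 1 \<in> {q $ 1 - \<delta>..q $ 1 + \<delta>} \<and> semicircle_height \<sigma> \<delta> q (p $ 1) = p $ 2"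
proof -
  define x y where "x = p $ 1 - q $ 1" and "y = p $ 2 - q $ 2"
  have "p \<in> semicircle \<sigma> \<delta> q \<longleftrightarrow> 0 \<le> \<delta> \<and> x\<^sup>2 + y\<^sup>2 = \<delta>\<^sup>2 \<and> 0 \<le> \<sigma> * y"
    by (simp add: semicircle_def dist_vec2_eq_iff x_def y_def)
  also have "\<dots> \<longleftrightarrow> (0 \<le> \<delta> \<and> x\<^sup>2 \<le> \<delta>\<^sup>2) \<and> y = \<sigma> * sqrt (\<delta>\<^sup>2 - x\<^sup>2)"
  proof safe
    assume circle: "x\<^sup>2 + y\<^sup>2 = \<delta>\<^sup>2" and side: "0 \<le> \<sigma> * y"
    then have "\<delta>\<^sup>2 - x\<^sup>2 = y\<^sup>2" by simp
    then have "sqrt (\<delta>\<^sup>2 - x\<^sup>2) = \<bar>y\<bar>" by (simp only: real_sqrt_abs)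
    then show "y = \<sigma> * sqrt (\<delta>\<^sup>2 - x\<^sup>2)" using side \<sigma> by auto
    show "x\<^sup>2 \<le> \<delta>\<^sup>2" using circle zero_le_power2[of y] by linarith
  qed (use \<sigma> in \<open>auto simp: power_mult_distrib\<close>)
  also have "0 \<le> \<delta> \<and> x\<^sup>2 \<le> \<delta>\<^sup>2 \<longleftrightarrow> - \<delta> \<le> x \<and> x \<le> \<delta>"
    using abs_le_square_iff[of x \<delta>] by linarith
  finally show ?thesis
    unfolding x_def y_def semicircle_height_def atLeastAtMost_iff by argo
qed

lemma semicircles_with_two_common_points_eq:
  assumes \<sigma>: "\<sigma> \<noteq> 0" and p: "p $ 1 \<noteq> p' $ 1"
    and q: "{p, p'} \<subseteq> semicircle \<sigma> \<delta> q" and q': "{p, p'} \<subseteq> semicircle \<sigma> \<delta> q'"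
  shows "q = q'"
proof -
  have "p \<noteq> p'" using p by auto
  then have "q' = q \<or> q' = p + p' - q"
    using q q' by (intro centre_eq_or_reflected[of p p' q \<delta> q']) (auto simp: semicircle_def)
  moreover have "q = q'" if reflected: "q' = p + p' - q"
  proof -
    have signs: "0 \<le> \<sigma> * (p $ 2 - q $ 2)" "0 \<le> \<sigma> * (p' $ 2 - q $ 2)"
      "0 \<le> \<sigma> * (q $ 2 - p' $ 2)" "0 \<le> \<sigma> * (q $ 2 - p $ 2)"
      using q q' by (simp_all add: semicircle_def reflected)
    then have heights: "p $ 2 = q $ 2" "p' $ 2 = q $ 2" using \<sigma> by (auto simp: zero_le_mult_iff)
    then have "(p $ 1 - q $ 1)\<^sup>2 = (p' $ 1 - q $ 1)\<^sup>2"
      using q by (simp add: semicircle_def dist_vec2_eq_iff)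
    then have "p $ 1 - q $ 1 = - (p' $ 1 - q $ 1)" using p by (auto simp: power2_eq_iff)
    then show "q = q'" using heights by (intro vec2_eqI) (simp_all add: reflected)
  qed
  ultimately show ?thesis by blast
qed

lemma pseudo_segments_semicircles:
  assumes "finite P" "finite Q" and \<sigma>: "\<sigma> \<in> {1, -1}"
  shows "pseudo_segments P Q (\<lambda>q. q $ 1 - \<delta>) (\<lambda>q. q $ 1 + \<delta>) (semicircle_height \<sigma> \<delta>)"
proof
  show "continuous_on {q $ 1 - \<delta>..q $ 1 + \<delta>} (semicircle_height \<sigma> \<delta> q)" for q :: "real^2"
    unfolding semicircle_height_def by (intro continuous_intros)
  fix q q' :: "real^2" and x x'
  assume "q \<noteq> q'"
    and x: "x \<in> {q $ 1 - \<delta>..q $ 1 + \<delta>} \<inter> {q' $ 1 - \<delta>..q' $ 1 + \<delta>}"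
      "semicircle_height \<sigma> \<delta> q x = semicircle_height \<sigma> \<delta> q' x"
    and x': "x' \<in> {q $ 1 - \<delta>..q $ 1 + \<delta>} \<inter> {q' $ 1 - \<delta>..q' $ 1 + \<delta>}"
      "semicircle_height \<sigma> \<delta> q x' = semicircle_height \<sigma> \<delta> q' x'"
  define p where "p x = (vector [x, semicircle_height \<sigma> \<delta> q x] :: real^2)" for x
  have "{p x, p x'} \<subseteq> semicircle \<sigma> \<delta> q" "{p x, p x'} \<subseteq> semicircle \<sigma> \<delta> q'"
    using x x' by (simp_all add: mem_semicircle_iff[OF \<sigma>] p_def)
  moreover have "\<sigma> \<noteq> 0" using \<sigma> by auto
  ultimately have "p x $ 1 = p x' $ 1"
    using semicircles_with_two_common_points_eq[of \<sigma> "p x" "p x'" \<delta> q q'] \<open>q \<noteq> q'\<close> by argo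
  then show "x = x'" by (simp add: p_def)
qed (use assms in auto)

definition distance_pairs :: "real \<Rightarrow> 'a::metric_space set \<Rightarrow> 'a set \<Rightarrow> ('a \<times> 'a) set" where
  "distance_pairs \<delta> P Q = {(p, q). p \<in> P \<and> q \<in> Q \<and> dist p q = \<delta>}"

lemma finite_distance_pairs: "finite P \<Longrightarrow> finite Q \<Longrightarrow> finite (distance_pairs \<delta> P Q)"
  by (rule finite_subset[of _ "P \<times> Q"]) (auto simp: distance_pairs_def)

theorem card_distance_pairs_le:
  fixes P Q :: "(real^2) set"
  assumes "finite P" "finite Q"
  shows "real (card (distance_pairs \<delta> P Q)) \<le>
    14 * (real (card P) * real (card Q)) powr (2/3) + 12 * real (card P) + 2 * real (card Q)"
proof -
  define I where "I \<sigma> = (SIGMA q:Q. {p\<in>P. p \<in> semicircle \<sigma> \<delta> q})" for \<sigma>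
  have finite_I: "finite (I \<sigma>)" for \<sigma> using assms by (simp add: I_def)
  have card_I_le: "real (card (I \<sigma>)) \<le>
      7 * (real (card P) * real (card Q)) powr (2/3) + 6 * real (card P) + real (card Q)"
    if \<sigma>: "\<sigma> \<in> {1, -1}" for \<sigma>
  proof -
    interpret pseudo_segments P Q "\<lambda>q. q $ 1 - \<delta>" "\<lambda>q. q $ 1 + \<delta>" "semicircle_height \<sigma> \<delta>"
      using assms \<sigma> by (rule pseudo_segments_semicircles)
    have "I \<sigma> = incidences"
      unfolding I_def incidences_def points_on_def mem_semicircle_iff[OF \<sigma>] ..
    then show ?thesis using card_incidences_le by simp
  qed
  have "distance_pairs \<delta> P Q \<subseteq> prod.swap ` (I 1 \<union> I (-1))"
    by (force simp: distance_pairs_def I_def semicircle_def image_Un dist_commute)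
  then have "card (distance_pairs \<delta> P Q) \<le> card (I 1 \<union> I (-1))"
    using finite_I by (intro surj_card_le) auto
  also have "\<dots> \<le> card (I 1) + card (I (-1))" by (rule card_Un_le)
  finally show ?thesis using card_I_le[of 1] card_I_le[of "-1"] by simp
qed

section \<open>Chains\<close>

lemma k_chains_0: "k_chains 0 P [] = (\<lambda>p. [p]) ` P"
  by (auto simp: k_chains_def length_Suc_conv)

lemma k_chains_nonempty: "ps \<in> k_chains k P ds \<Longrightarrow> ps \<noteq> []"
  by (auto simp: k_chains_def)

lemma k_chains_appendE:
  assumes ps: "ps \<in> k_chains (Suc (i + j)) P (ds @ \<delta> # es)" and len: "length ds = i"
  obtains qs rs where "ps = qs @ rs" "qs \<in> k_chains i P ds" "rs \<in> k_chains j P es"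
    "set qs \<inter> set rs = {}" "dist (last qs) (hd rs) = \<delta>"
proof -
  define qs rs where "qs = take (Suc i) ps" and "rs = drop (Suc i) ps"
  have split: "ps = qs @ rs" by (simp add: qs_def rs_def)
  have lens: "length qs = Suc i" "length rs = Suc j"
    using ps by (simp_all add: qs_def rs_def k_chains_def)
  have steps: "dist (ps ! m) (ps ! Suc m) = (ds @ \<delta> # es) ! m" if "m < Suc (i + j)" for m
    using ps that by (simp add: k_chains_def)
  have "dist (qs ! m) (qs ! Suc m) = ds ! m" if "m < i" for m
    using steps[of m] that lens len by (simp add: split nth_append)
  moreover have "dist (rs ! m) (rs ! Suc m) = es ! m" if "m < j" for m
    using steps[of "Suc i + m"] that lens len by (simp add: split nth_append)
  moreover have "dist (last qs) (hd rs) = \<delta>"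
    using steps[of i] lens len
    by (simp add: split nth_append last_conv_nth hd_conv_nth flip: length_greater_0_conv)
  moreover have "distinct (qs @ rs)" "set (qs @ rs) \<subseteq> P"
    using ps by (simp_all add: k_chains_def split)
  ultimately show ?thesis
    using split lens that[of qs rs] by (auto simp: k_chains_def)
qed

lemma k_chains_rev:
  assumes ps: "ps \<in> k_chains k P ds" and len: "length ds = k"
  shows "rev ps \<in> k_chains k P (rev ds)"
proof -
  have "dist (rev ps ! j) (rev ps ! (j + 1)) = rev ds ! j" if j: "j < k" for j
  proof -
    have "rev ps ! j = ps ! (k - Suc j + 1)" "rev ps ! (j + 1) = ps ! (k - Suc j)"
      "rev ds ! j = ds ! (k - Suc j)"
      using j ps len by (simp_all add: k_chains_def rev_nth Suc_diff_Suc)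
    moreover have "dist (ps ! (k - Suc j)) (ps ! (k - Suc j + 1)) = ds ! (k - Suc j)"
      using ps j by (simp add: k_chains_def)
    ultimately show ?thesis by (simp add: dist_commute)
  qed
  then show ?thesis using ps by (simp add: k_chains_def)
qed

lemma card_k_chains_1_le:
  assumes "finite P"
  shows "card (k_chains 1 P [\<delta>]) \<le> card (distance_pairs \<delta> P P)"
proof (rule surj_card_le[where f = "\<lambda>(p, q). [p, q]"])
  show "finite (distance_pairs \<delta> P P)" using assms by (intro finite_distance_pairs)
  show "k_chains 1 P [\<delta>] \<subseteq> (\<lambda>(p, q). [p, q]) ` distance_pairs \<delta> P P"
    by (force simp: k_chains_def distance_pairs_def length_Suc_conv)
qed

text \<open>The joining point of two given chains lies on two circles with distinct centres.\<close>

lemma card_joined_chains_le: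
  fixes A B C :: "'a::euclidean_space list set"
  assumes dim: "DIM('a) = 2" and "finite A" "finite B"
    and C: "\<And>ps. ps \<in> C \<Longrightarrow> \<exists>qs\<in>A. \<exists>rs\<in>B. \<exists>z. ps = qs @ z # rs \<and> last qs \<noteq> hd rs \<and>
      dist (last qs) z = \<delta> \<and> dist z (hd rs) = \<epsilon>"
  shows "card C \<le> 2 * (card A * card B)"
proof -
  define Z where "Z = (\<lambda>(qs, rs). sphere (last qs) \<delta> \<inter> sphere (hd rs :: 'a) \<epsilon>)"
  define D where "D = {(qs, rs)\<in>A \<times> B. last qs \<noteq> hd rs}"
  have D: "finite D" "card D \<le> card A * card B"
    using assms(2,3) card_mono[of "A \<times> B" D] finite_subset[of D "A \<times> B"]
    by (auto simp: D_def card_cartesian_product)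
  have Z: "finite (Z b) \<and> card (Z b) \<le> 2" if "b \<in> D" for b
    using that by (auto simp: D_def Z_def dim intro!: finite_sphere_Int_sphere card_sphere_Int_sphere_le)
  have "C \<subseteq> (\<lambda>((qs, rs), z). qs @ z # rs) ` (SIGMA b:D. Z b)"
  proof
    fix ps assume "ps \<in> C"
    then obtain qs rs z where "qs \<in> A" "rs \<in> B" "ps = qs @ z # rs" "last qs \<noteq> hd rs"
      "dist (last qs) z = \<delta>" "dist z (hd rs) = \<epsilon>" using C by blast
    then show "ps \<in> (\<lambda>((qs, rs), z). qs @ z # rs) ` (SIGMA b:D. Z b)"
      by (intro image_eqI[of _ _ "((qs, rs), z)"]) (simp_all add: D_def Z_def dist_commute)
  qed
  then have "card C \<le> card (SIGMA b:D. Z b)" using D(1) Z by (intro surj_card_le) auto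
  also have "\<dots> = (\<Sum>b\<in>D. card (Z b))" using D(1) Z by simp
  also have "\<dots> \<le> (\<Sum>b\<in>D. 2)" using Z by (intro sum_mono) auto
  also have "\<dots> \<le> 2 * (card A * card B)" using D(2) by simp
  finally show ?thesis .
qed

lemma k_chains_joinE:
  assumes ps: "ps \<in> k_chains (Suc (Suc (i + j))) P (ds @ \<delta> # \<epsilon> # es)" and len: "length ds = i"
  obtains qs rs z where "ps = qs @ z # rs" "qs \<in> k_chains i P ds" "rs \<in> k_chains j P es"
    "last qs \<noteq> hd rs" "dist (last qs) z = \<delta>" "dist z (hd rs) = \<epsilon>"
proof -
  have "ps \<in> k_chains (Suc (i + Suc j)) P (ds @ \<delta> # \<epsilon> # es)" using ps by simp
  then obtain qs ts where qs: "ps = qs @ ts" "qs \<in> k_chains i P ds" "ts \<in> k_chains (Suc j) P (\<epsilon> # es)"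
    "set qs \<inter> set ts = {}" "dist (last qs) (hd ts) = \<delta>"
    using len by (rule k_chains_appendE)
  have "ts \<in> k_chains (Suc (0 + j)) P ([] @ \<epsilon> # es)" using qs(3) by simp
  then obtain zs rs where rs: "ts = zs @ rs" "zs \<in> k_chains 0 P []" "rs \<in> k_chains j P es"
    "dist (last zs) (hd rs) = \<epsilon>"
    by (rule k_chains_appendE) simp
  moreover obtain z where "zs = [z]" using rs(2) by (auto simp: k_chains_0)
  moreover have "last qs \<in> set qs" "hd rs \<in> set ts"
    using rs(1) k_chains_nonempty[OF qs(2)] k_chains_nonempty[OF rs(3)] by auto
  then have "last qs \<noteq> hd rs" using qs(4) by auto
  ultimately show ?thesis using that qs by simp
qed

lemma card_k_chains_2_le:
  assumes "finite P"
  shows "card (k_chains 2 P [\<delta>, \<epsilon>]) \<le> 2 * (card P)\<^sup>2"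
proof -
  have "card (k_chains 2 P [\<delta>, \<epsilon>]) \<le> 2 * (card (k_chains 0 P []) * card (k_chains 0 P []))"
  proof (rule card_joined_chains_le[of _ _ _ \<delta> \<epsilon>])
    fix ps assume "ps \<in> k_chains 2 P [\<delta>, \<epsilon>]"
    then have "ps \<in> k_chains (Suc (Suc (0 + 0))) P ([] @ \<delta> # \<epsilon> # [])" by (simp add: numeral_2_eq_2)
    then show "\<exists>qs\<in>k_chains 0 P []. \<exists>rs\<in>k_chains 0 P []. \<exists>z. ps = qs @ z # rs \<and> last qs \<noteq> hd rs \<and>
        dist (last qs) z = \<delta> \<and> dist z (hd rs) = \<epsilon>"
      by (rule k_chains_joinE) auto
  qed (simp_all add: assms finite_k_chains)
  also have "card (k_chains 0 P []) = card P"
    unfolding k_chains_0 by (intro card_image inj_onI) simp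
  finally show ?thesis by (simp add: power2_eq_square)
qed

definition heavy :: "'a::metric_space set \<Rightarrow> real \<Rightarrow> real \<Rightarrow> 'a set" where
  "heavy P \<delta> t = {p\<in>P. t < real (card (P \<inter> sphere p \<delta>))}"

lemma finite_heavy: "finite P \<Longrightarrow> finite (heavy P \<delta> t)"
  by (simp add: heavy_def)

lemma threshold_mult_card_heavy_le:
  assumes "finite P"
  shows "t * real (card (heavy P \<delta> t)) \<le> real (card (distance_pairs \<delta> P (heavy P \<delta> t)))"
proof -
  have "distance_pairs \<delta> P (heavy P \<delta> t) = prod.swap ` (SIGMA p:heavy P \<delta> t. P \<inter> sphere p \<delta>)"
    by (force simp: distance_pairs_def dist_commute)
  then have "real (card (distance_pairs \<delta> P (heavy P \<delta> t))) =
      (\<Sum>p\<in>heavy P \<delta> t. real (card (P \<inter> sphere p \<delta>)))"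
    using assms finite_heavy[OF assms] by (simp add: card_image)
  also have "\<dots> \<ge> (\<Sum>p\<in>heavy P \<delta> t. t)" by (intro sum_mono) (auto simp: heavy_def)
  finally show ?thesis by (simp add: mult.commute)
qed

lemma card_heavy_distance_pairs_le:
  fixes P :: "(real^2) set"
  assumes P: "finite P" and t: "t > 0"
  shows "real (card (distance_pairs \<delta> P (heavy P \<delta> t)))
    \<le> 21952 * ((real (card P))\<^sup>2 / t\<^sup>2 + real (card P))"
proof -
  define H n h I where "H = heavy P \<delta> t" and "n = real (card P)" and "h = real (card H)"
    and "I = real (card (distance_pairs \<delta> P H))"
  have H: "finite H" "H \<subseteq> P" using P by (auto simp: H_def heavy_def)
  have threshold: "t * h \<le> I"
    using threshold_mult_card_heavy_le[OF P] by (simp add: h_def I_def H_def)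
  have "h \<le> n" using card_mono[OF P H(2)] by (simp add: h_def n_def)
  then have incidences: "I \<le> 14 * (n * h) powr (2/3) + 14 * n"
    using card_distance_pairs_le[OF P H(1), of \<delta>] by (simp add: I_def n_def h_def)
  have "I \<le> 21952 * (n\<^sup>2 / t\<^sup>2 + n)"
  proof (cases "n \<le> (n * h) powr (2/3)")
    case False
    then have "I \<le> 28 * n" using incidences by linarith
    also have "\<dots> \<le> 21952 * (n\<^sup>2 / t\<^sup>2 + n)" by (simp add: n_def)
    finally show ?thesis .
  next
    case True
    then have "I \<le> 28 * (n * h) powr (2/3)" using incidences by linarith
    then have "I ^ 3 \<le> (28 * (n * h) powr (2/3)) ^ 3" by (rule power_mono) (simp add: I_def)
    also have "\<dots> = 21952 * (n * h)\<^sup>2"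
      by (cases "n * h = 0") (auto simp: n_def h_def power_mult_distrib powr_power powr_numeral)
    finally have "t\<^sup>2 * I ^ 3 \<le> 21952 * n\<^sup>2 * (t * h)\<^sup>2"
      using mult_left_mono[of "I ^ 3" "21952 * (n * h)\<^sup>2" "t\<^sup>2"]
      by (simp add: power_mult_distrib algebra_simps)
    also have "\<dots> \<le> 21952 * n\<^sup>2 * I\<^sup>2"
      using threshold t by (intro mult_left_mono power_mono) (simp_all add: h_def)
    finally have "I\<^sup>2 * (t\<^sup>2 * I) \<le> I\<^sup>2 * (21952 * n\<^sup>2)"
      by (simp add: power_numeral_reduce algebra_simps)
    then have "I = 0 \<or> t\<^sup>2 * I \<le> 21952 * n\<^sup>2" by (auto simp: mult_le_cancel_left)
    then have "I \<le> 21952 * (n\<^sup>2 / t\<^sup>2)" using t by (auto simp: field_simps)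
    then show ?thesis by (simp add: n_def)
  qed
  then show ?thesis by (simp add: I_def n_def H_def)
qed

definition heavy_chains :: "nat \<Rightarrow> (real^2) set \<Rightarrow> real list \<Rightarrow> real \<Rightarrow> (real^2) list set" where
  "heavy_chains k P ds t = {ps \<in> k_chains k P ds. ps ! 1 \<in> heavy P (hd ds) t}"

definition light_chains :: "nat \<Rightarrow> (real^2) set \<Rightarrow> real list \<Rightarrow> real \<Rightarrow> (real^2) list set" where
  "light_chains k P ds t =
     {ps \<in> k_chains k P ds. ps ! 1 \<notin> heavy P (hd ds) t \<and> rev ps ! 1 \<notin> heavy P (last ds) t}"

lemma card_k_chains_le_light_add_heavy:
  assumes P: "finite P" and len: "length ds = k"
  shows "card (k_chains k P ds) \<le>
    card (light_chains k P ds t) + card (heavy_chains k P ds t) + card (heavy_chains k P (rev ds) t)"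
proof -
  let ?reversed = "rev ` heavy_chains k P (rev ds) t"
  have "k_chains k P ds \<subseteq> light_chains k P ds t \<union> heavy_chains k P ds t \<union> ?reversed"
  proof
    fix ps assume ps: "ps \<in> k_chains k P ds"
    have "ps \<in> ?reversed" if "rev ps ! 1 \<in> heavy P (last ds) t"
      using k_chains_rev[OF ps len] that
      by (intro image_eqI[of _ _ "rev ps"]) (simp_all add: heavy_chains_def hd_rev)
    then show "ps \<in> light_chains k P ds t \<union> heavy_chains k P ds t \<union> ?reversed"
      using ps by (auto simp: light_chains_def heavy_chains_def)
  qed
  then have "card (k_chains k P ds) \<le> card (light_chains k P ds t \<union> heavy_chains k P ds t \<union> ?reversed)"
    using finite_k_chains[OF P] by (intro card_mono) (simp_all add: light_chains_def heavy_chains_def)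
  also have "\<dots> \<le> card (light_chains k P ds t) + card (heavy_chains k P ds t) + card ?reversed"
    by (meson card_Un_le add_right_mono order_trans)
  also have "card ?reversed = card (heavy_chains k P (rev ds) t)" by (intro card_image) simp
  finally show ?thesis .
qed

lemma card_heavy_chains_le:
  assumes P: "finite P"
  shows "card (heavy_chains (k + 3) P (\<alpha> # \<delta> # \<epsilon> # ds) t)
    \<le> 2 * (card (distance_pairs \<alpha> P (heavy P \<alpha> t)) * card (k_chains k P ds))"
proof -
  define I where "I = distance_pairs \<alpha> P (heavy P \<alpha> t)"
  let ?A = "(\<lambda>(q, p). [q, p]) ` I"
  have I: "finite I" using P by (simp add: I_def finite_distance_pairs finite_heavy)
  have "card (heavy_chains (k + 3) P (\<alpha> # \<delta> # \<epsilon> # ds) t) \<le> 2 * (card ?A * card (k_chains k P ds))"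
  proof (rule card_joined_chains_le[of _ _ _ \<delta> \<epsilon>])
    fix ps assume ps: "ps \<in> heavy_chains (k + 3) P (\<alpha> # \<delta> # \<epsilon> # ds) t"
    then have "ps \<in> k_chains (Suc (Suc (1 + k))) P ([\<alpha>] @ \<delta> # \<epsilon> # ds)"
      by (simp add: heavy_chains_def numeral_3_eq_3)
    then obtain qs rs z where join: "ps = qs @ z # rs" "qs \<in> k_chains 1 P [\<alpha>]" "rs \<in> k_chains k P ds"
      "last qs \<noteq> hd rs" "dist (last qs) z = \<delta>" "dist z (hd rs) = \<epsilon>"
      by (rule k_chains_joinE) auto
    have "qs \<in> ?A"
      using ps join(1,2)
      by (force simp: heavy_chains_def I_def k_chains_def distance_pairs_def length_Suc_conv)
    with join show "\<exists>qs\<in>?A. \<exists>rs\<in>k_chains k P ds. \<exists>z. ps = qs @ z # rs \<and> last qs \<noteq> hd rs \<and>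
        dist (last qs) z = \<delta> \<and> dist z (hd rs) = \<epsilon>" by blast
  qed (simp_all add: P I finite_k_chains)
  then show ?thesis
    unfolding I_def[symmetric] using card_image_le[OF I, of "\<lambda>(q, p). [q, p]"]
    by (meson le_trans mult_le_mono order_refl)
qed

lemma k_chains_trimE:
  assumes ps: "ps \<in> k_chains (k + 2) P (\<alpha> # ds @ [\<beta>])" and len: "length ds = k"
  obtains p qs r where "ps = p # qs @ [r]" "qs \<in> k_chains k P ds" "p \<in> P" "r \<in> P"
    "dist p (hd qs) = \<alpha>" "dist (last qs) r = \<beta>"
proof -
  have "ps \<in> k_chains (Suc (0 + Suc k)) P ([] @ \<alpha> # ds @ [\<beta>])" using ps by simp
  then obtain us ts where us: "ps = us @ ts" "us \<in> k_chains 0 P []"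
    "ts \<in> k_chains (Suc (k + 0)) P (ds @ \<beta> # [])" "dist (last us) (hd ts) = \<alpha>"
    by (rule k_chains_appendE) auto
  obtain qs vs where vs: "ts = qs @ vs" "qs \<in> k_chains k P ds" "vs \<in> k_chains 0 P []"
    "dist (last qs) (hd vs) = \<beta>"
    using us(3) len by (rule k_chains_appendE)
  obtain p r where "us = [p]" "vs = [r]" "p \<in> P" "r \<in> P" using us(2) vs(3) by (auto simp: k_chains_0)
  then show ?thesis using us(1,4) vs k_chains_nonempty[OF vs(2)] by (intro that[of p qs r]) simp_all
qed

lemma card_light_chains_le:
  assumes P: "finite P" and len: "length ds = k" and t: "t \<ge> 0"
  shows "real (card (light_chains (k + 2) P (\<alpha> # ds @ [\<beta>]) t)) \<le> t\<^sup>2 * real (card (k_chains k P ds))"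
proof -
  define M where "M = {qs \<in> k_chains k P ds. hd qs \<notin> heavy P \<alpha> t \<and> last qs \<notin> heavy P \<beta> t}"
  define N where "N qs = (P \<inter> sphere (hd qs) \<alpha>) \<times> (P \<inter> sphere (last qs) \<beta>)" for qs
  have M: "finite M" "M \<subseteq> k_chains k P ds" using P finite_k_chains by (auto simp: M_def)
  have "light_chains (k + 2) P (\<alpha> # ds @ [\<beta>]) t \<subseteq> (\<lambda>(qs, p, r). p # qs @ [r]) ` (SIGMA qs:M. N qs)"
  proof
    fix ps assume ps: "ps \<in> light_chains (k + 2) P (\<alpha> # ds @ [\<beta>]) t"
    then have "ps \<in> k_chains (k + 2) P (\<alpha> # ds @ [\<beta>])" by (simp add: light_chains_def)
    then obtain p qs r where trim: "ps = p # qs @ [r]" "qs \<in> k_chains k P ds" "p \<in> P" "r \<in> P"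
      "dist p (hd qs) = \<alpha>" "dist (last qs) r = \<beta>"
      using len by (rule k_chains_trimE)
    then have "ps ! 1 = hd qs" "rev ps ! 1 = last qs"
      using k_chains_nonempty[of qs] by (simp_all add: nth_append hd_conv_nth hd_rev[symmetric])
    then have "qs \<in> M" "(p, r) \<in> N qs"
      using ps trim by (simp_all add: light_chains_def M_def N_def dist_commute)
    then show "ps \<in> (\<lambda>(qs, p, r). p # qs @ [r]) ` (SIGMA qs:M. N qs)"
      by (intro image_eqI[of _ _ "(qs, p, r)"]) (simp_all add: trim(1))
  qed
  then have "card (light_chains (k + 2) P (\<alpha> # ds @ [\<beta>]) t) \<le> card (SIGMA qs:M. N qs)"
    using M(1) P by (intro surj_card_le) (auto simp: N_def)
  also have "\<dots> = (\<Sum>qs\<in>M. card (N qs))" using M(1) P by (intro card_SigmaI) (auto simp: N_def)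
  finally have "real (card (light_chains (k + 2) P (\<alpha> # ds @ [\<beta>]) t)) \<le> (\<Sum>qs\<in>M. real (card (N qs)))"
    by (simp flip: of_nat_sum)
  also have "\<dots> \<le> (\<Sum>qs\<in>M. t * t)"
  proof (intro sum_mono)
    fix qs assume qs: "qs \<in> M"
    then have "qs \<noteq> []" "set qs \<subseteq> P" using k_chains_nonempty by (auto simp: M_def k_chains_def)
    then have "hd qs \<in> P" "last qs \<in> P" by auto
    then have "real (card (P \<inter> sphere (hd qs) \<alpha>)) \<le> t" "real (card (P \<inter> sphere (last qs) \<beta>)) \<le> t"
      using qs by (auto simp: M_def heavy_def)
    then show "real (card (N qs)) \<le> t * t"
      using t by (simp add: N_def card_cartesian_product mult_mono)
  qed
  also have "\<dots> = t\<^sup>2 * real (card M)" by (simp add: power2_eq_square)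
  also have "\<dots> \<le> t\<^sup>2 * real (card (k_chains k P ds))"
    using card_mono[OF finite_k_chains[OF P] M(2)] by (intro mult_left_mono) simp_all
  finally show ?thesis .
qed

section \<open>The recursion for the maximum number of chains\<close>

lemma card_k_chains_le_max_chains:
  assumes "finite P" "length ds = k" "\<forall>\<delta>\<in>set ds. \<delta> > 0"
  shows "card (k_chains k P ds) \<le> max_chains k (card P)"
  unfolding max_chains_def using assms
  by (intro Max_ge finite_chain_counts) (auto simp: chain_counts_def)

lemma max_chains_attained:
  obtains P ds where "max_chains k n = card (k_chains k P ds)" "finite P" "card P = n" "length ds = k"
    "\<forall>\<delta>\<in>set ds. \<delta> > 0"
proof -
  have "max_chains k n \<in> chain_counts k n"
    unfolding max_chains_def by (intro Max_in finite_chain_counts chain_counts_nonempty)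
  then show ?thesis using that unfolding chain_counts_def by blast
qed

lemma max_chains_0_le: "max_chains 0 n \<le> n"
proof -
  obtain P ds where "max_chains 0 n = card (k_chains 0 P ds)" "finite P" "card P = n" "length ds = 0"
    by (rule max_chains_attained)
  then show ?thesis using card_image_le[of P "\<lambda>p. [p]"] by (simp add: k_chains_0)
qed

lemma max_chains_1_le: "real (max_chains 1 n) \<le> 28 * real n powr (4/3)"
proof -
  obtain P ds where P: "max_chains 1 n = card (k_chains 1 P ds)" "finite P" "card P = n" "length ds = 1"
    by (rule max_chains_attained)
  obtain \<delta> where "ds = [\<delta>]" using P(4) by (auto simp: length_Suc_conv)
  then have "real (max_chains 1 n) \<le> real (card (distance_pairs \<delta> P P))"
    using card_k_chains_1_le[OF P(2)] P(1) by simp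
  also have "\<dots> \<le> 14 * (real n * real n) powr (2/3) + 14 * real n"
    using card_distance_pairs_le[OF P(2) P(2), of \<delta>] P(3) by simp
  finally have "real (max_chains 1 n) \<le> 14 * (real n * real n) powr (2/3) + 14 * real n" .
  moreover have "(real n * real n) powr (2/3) = real n powr (4/3)"
    by (simp add: powr_mult flip: powr_add)
  moreover have "real n \<le> real n powr (4/3)"
    using powr_mono[of 1 "4/3" "real n"] by (cases "n = 0") auto
  ultimately show ?thesis by linarith
qed

lemma max_chains_2_le: "max_chains 2 n \<le> 2 * n\<^sup>2"
proof -
  obtain P ds where P: "max_chains 2 n = card (k_chains 2 P ds)" "finite P" "card P = n" "length ds = 2"
    by (rule max_chains_attained)
  then show ?thesis using card_k_chains_2_le[OF P(2)] by (auto simp: length_Suc_conv numeral_2_eq_2)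
qed

lemma card_heavy_chains_le_max_chains:
  assumes P: "finite P" and t: "t > 0" and ds: "length ds = k + 3" "\<forall>\<delta>\<in>set ds. \<delta> > 0"
  shows "real (card (heavy_chains (k + 3) P ds t)) \<le>
    43904 * (((real (card P))\<^sup>2 / t\<^sup>2 + real (card P)) * real (max_chains k (card P)))"
proof -
  obtain \<alpha> \<delta> \<epsilon> es where split: "ds = \<alpha> # \<delta> # \<epsilon> # es"
    using ds(1) by (auto simp: length_Suc_conv numeral_3_eq_3)
  have "card (heavy_chains (k + 3) P ds t) \<le>
      2 * (card (distance_pairs \<alpha> P (heavy P \<alpha> t)) * card (k_chains k P es))"
    unfolding split by (rule card_heavy_chains_le[OF P])
  also have "\<dots> \<le> 2 * (card (distance_pairs \<alpha> P (heavy P \<alpha> t)) * max_chains k (card P))"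
    using card_k_chains_le_max_chains[OF P, of es k] ds by (simp add: split)
  finally have "real (card (heavy_chains (k + 3) P ds t)) \<le>
      2 * (real (card (distance_pairs \<alpha> P (heavy P \<alpha> t))) * real (max_chains k (card P)))"
    by (simp flip: of_nat_mult)
  also have "\<dots> \<le> 2 * (21952 * ((real (card P))\<^sup>2 / t\<^sup>2 + real (card P)) * real (max_chains k (card P)))"
    by (intro mult_left_mono mult_right_mono card_heavy_distance_pairs_le P t) auto
  finally show ?thesis by (simp add: algebra_simps)
qed

lemma card_light_chains_le_max_chains:
  assumes P: "finite P" and t: "t > 0" and ds: "length ds = k + 2" "\<forall>\<delta>\<in>set ds. \<delta> > 0"
  shows "real (card (light_chains (k + 2) P ds t)) \<le> t\<^sup>2 * real (max_chains k (card P))"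
proof -
  obtain \<alpha> ts where "ds = \<alpha> # ts" using ds(1) by (cases ds) auto
  moreover from this obtain es \<beta> where "ts = es @ [\<beta>]" using ds(1) by (cases ts rule: rev_cases) auto
  ultimately have split: "ds = \<alpha> # es @ [\<beta>]" by simp
  then have len: "length es = k" using ds(1) by simp
  then have "real (card (light_chains (k + 2) P ds t)) \<le> t\<^sup>2 * real (card (k_chains k P es))"
    unfolding split using t by (intro card_light_chains_le P) simp_all
  also have "\<dots> \<le> t\<^sup>2 * real (max_chains k (card P))"
    using card_k_chains_le_max_chains[OF P len] ds(2) by (intro mult_left_mono) (simp_all add: split)
  finally show ?thesis .
qed

theorem max_chains_recursion:
  assumes t: "t > 0"
  shows "real (max_chains (k + 3) n) \<le> t\<^sup>2 * real (max_chains (k + 1) n) +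
    87808 * (((real n)\<^sup>2 / t\<^sup>2 + real n) * real (max_chains k n))"
proof -
  define B where "B = ((real n)\<^sup>2 / t\<^sup>2 + real n) * real (max_chains k n)"
  obtain P ds where P: "max_chains (k + 3) n = card (k_chains (k + 3) P ds)" "finite P" "card P = n"
    and ds: "length ds = k + 3" "\<forall>\<delta>\<in>set ds. \<delta> > 0"
    by (rule max_chains_attained)
  have "real (max_chains (k + 3) n) \<le> real (card (light_chains (k + 3) P ds t)) +
      real (card (heavy_chains (k + 3) P ds t)) + real (card (heavy_chains (k + 3) P (rev ds) t))"
    unfolding P(1) using card_k_chains_le_light_add_heavy[OF P(2) ds(1), of t] by linarith
  moreover have "real (card (light_chains (k + 3) P ds t)) \<le> t\<^sup>2 * real (max_chains (k + 1) n)"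
    using card_light_chains_le_max_chains[OF P(2) t, of ds "k + 1"] ds P(3) by (simp add: numeral_3_eq_3)
  moreover have "real (card (heavy_chains (k + 3) P ds t)) \<le> 43904 * B"
    "real (card (heavy_chains (k + 3) P (rev ds) t)) \<le> 43904 * B"
    unfolding B_def P(3)[symmetric]
    by (rule card_heavy_chains_le_max_chains[OF P(2) t]; use ds in simp)+
  ultimately have "real (max_chains (k + 3) n) \<le> t\<^sup>2 * real (max_chains (k + 1) n) + 87808 * B"
    by linarith
  then show ?thesis by (simp add: B_def)
qed

section \<open>The exponents\<close>

definition chain_exponent :: "nat \<Rightarrow> real" where
  "chain_exponent k = 2 * real k / 5 + 1 + chain_gamma k"

lemma chain_exponent_base: "chain_exponent 0 = 1" "chain_exponent 1 = 4/3" "chain_exponent 2 = 2"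
  by (simp_all add: chain_exponent_def chain_gamma_def)

lemma chain_exponent_eqs:
  "chain_exponent (4 * j) = 8 * real j / 5 + 79 / 75 - 4 / 75 * (-1/4) ^ j" (is ?eq0)
  "chain_exponent (4 * j + 1) = 8 * real j / 5 + 109 / 75 - 9 / 75 * (-1/4) ^ j" (is ?eq1)
  "chain_exponent (4 * j + 2) = 8 * real j / 5 + 139 / 75 + 11 / 75 * (-1/4) ^ j" (is ?eq2)
  "chain_exponent (4 * j + 3) = 8 * real j / 5 + 169 / 75 - 13 / 150 * (-1/4) ^ j" (is ?eq3)
proof -
  have div_mod:
    "(4 * j) div 4 = j" "(4 * j + 1) div 4 = j" "(4 * j + 2) div 4 = j" "(4 * j + 3) div 4 = j"
    "(4 * j) mod 4 = 0" "(4 * j + 1) mod 4 = 1" "(4 * j + 2) mod 4 = 2" "(4 * j + 3) mod 4 = 3"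
    by presburger+
  show ?eq0 ?eq1 ?eq2 ?eq3
    unfolding chain_exponent_def chain_gamma_def div_mod by (simp_all add: field_simps)
qed

lemma chain_exponent_rec:
  "chain_exponent (k + 3) = (chain_exponent k + chain_exponent (k + 1)) / 2 + 1"
proof -
  define j where "j = k div 4"
  consider "k = 4 * j" | "k = 4 * j + 1" | "k = 4 * j + 2" | "k = 4 * j + 3"
    unfolding j_def by linarith
  then show ?thesis
  proof cases
    case 1
    then show ?thesis unfolding 1 chain_exponent_eqs by (simp add: field_simps)
  next
    case 2
    then have shifted: "k + 3 = 4 * Suc j" "k + 1 = 4 * j + 2" by simp_all
    show ?thesis unfolding shifted unfolding 2 chain_exponent_eqs by (simp add: field_simps)
  next
    case 3
    then have shifted: "k + 3 = 4 * Suc j + 1" "k + 1 = 4 * j + 3" by simp_all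
    show ?thesis unfolding shifted unfolding 3 chain_exponent_eqs by (simp add: field_simps)
  next
    case 4
    then have shifted: "k + 3 = 4 * Suc j + 2" "k + 1 = 4 * Suc j" by simp_all
    show ?thesis unfolding shifted unfolding 4 chain_exponent_eqs by (simp add: field_simps)
  qed
qed

lemma nat_induct_3 [case_names 0 1 2 step]:
  fixes k :: nat
  assumes "Q 0" "Q 1" "Q 2" and step: "\<And>k. Q k \<Longrightarrow> Q (k + 1) \<Longrightarrow> Q (k + 3)"
  shows "Q k"
proof (induction k rule: less_induct)
  case (less k)
  show ?case
  proof (cases "k < 3")
    case True
    then have "k = 0 \<or> k = 1 \<or> k = 2" by linarith
    then show ?thesis using assms(1-3) by auto
  next
    case False
    then have "Q (k - 3 + 3)" by (intro step less.IH) simp_all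
    then show ?thesis using False by simp
  qed
qed

lemma chain_exponent_mono: "chain_exponent k \<le> chain_exponent (k + 1)"
proof (induction k rule: nat_induct_3)
  case (step k)
  then show ?case
    using chain_exponent_rec[of k] chain_exponent_rec[of "k + 1"]
    by (simp add: add.commute add.left_commute)
next
  case 2
  then show ?case using chain_exponent_base chain_exponent_rec[of 0] by simp
qed (use chain_exponent_base in \<open>simp_all add: numeral_2_eq_2\<close>)

text \<open>The threshold \<open>t\<close> balances \<open>t\<^sup>2 n\<^sup>b\<close> against \<open>n\<^sup>2 / t\<^sup>2 n\<^sup>a\<close>.\<close>

lemma max_chains_bigo_step:
  assumes a: "(\<lambda>n. real (max_chains k n)) \<in> O(\<lambda>n. real n powr a)"
    and b: "(\<lambda>n. real (max_chains (k + 1) n)) \<in> O(\<lambda>n. real n powr b)" and "a \<le> b"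
  shows "(\<lambda>n. real (max_chains (k + 3) n)) \<in> O(\<lambda>n. real n powr ((a + b) / 2 + 1))"
proof -
  define s where "s = 1 + (a - b) / 2"
  have exponents: "s + b = (a + b) / 2 + 1" "2 - s + a = (a + b) / 2 + 1"
    by (simp_all add: s_def field_simps)
  let ?f = "\<lambda>n. real n powr s * real (max_chains (k + 1) n) +
    175616 * (real n powr (2 - s) * real (max_chains k n))"
  have "real (max_chains (k + 3) n) \<le> ?f n" if "n \<ge> 1" for n
  proof -
    define t where "t = real n powr (s / 2)"
    have "t > 0" using that by (simp add: t_def)
    have t_squared: "t\<^sup>2 = real n powr s" using that by (simp add: t_def powr_power)
    then have "(real n)\<^sup>2 / t\<^sup>2 = real n powr (2 - s)" using that by (simp add: powr_diff powr_numeral)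
    moreover have "real n \<le> real n powr (2 - s)"
      using that powr_mono[of 1 "2 - s" "real n"] \<open>a \<le> b\<close> by (simp add: s_def)
    ultimately have "(real n)\<^sup>2 / t\<^sup>2 + real n \<le> 2 * real n powr (2 - s)" by simp
    then have "87808 * (((real n)\<^sup>2 / t\<^sup>2 + real n) * real (max_chains k n)) \<le>
        87808 * (2 * real n powr (2 - s) * real (max_chains k n))"
      by (intro mult_right_mono mult_left_mono) auto
    then show ?thesis using max_chains_recursion[OF \<open>t > 0\<close>, of k n] unfolding t_squared by linarith
  qed
  then have "(\<lambda>n. real (max_chains (k + 3) n)) \<in> O(?f)"
    by (intro landau_o.big_mono eventually_mono[OF eventually_ge_at_top[of 1]]) fastforce
  also have "?f \<in> O(\<lambda>n. real n powr ((a + b) / 2 + 1))"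
  proof (rule sum_in_bigo)
    have "(\<lambda>n. real n powr s * real (max_chains (k + 1) n)) \<in> O(\<lambda>n. real n powr s * real n powr b)"
      using b by (rule landau_o.big.mult_left)
    then show "(\<lambda>n. real n powr s * real (max_chains (k + 1) n)) \<in> O(\<lambda>n. real n powr ((a + b) / 2 + 1))"
      by (simp add: exponents flip: powr_add)
    have "(\<lambda>n. real n powr (2 - s) * real (max_chains k n)) \<in> O(\<lambda>n. real n powr (2 - s) * real n powr a)"
      using a by (rule landau_o.big.mult_left)
    then show "(\<lambda>n. 175616 * (real n powr (2 - s) * real (max_chains k n)))
        \<in> O(\<lambda>n. real n powr ((a + b) / 2 + 1))"
      by (simp add: exponents flip: powr_add)
  qed
  finally show ?thesis .
qed

lemma max_chains_bigo: "(\<lambda>n. real (max_chains k n)) \<in> O(\<lambda>n. real n powr chain_exponent k)"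
proof (induction k rule: nat_induct_3)
  case 0
  show ?case unfolding chain_exponent_base
    using max_chains_0_le by (intro bigoI[of _ 1] always_eventually allI) simp
next
  case 1
  show ?case unfolding chain_exponent_base
    using max_chains_1_le by (intro bigoI[of _ 28] always_eventually allI) simp
next
  case 2
  have "real (max_chains 2 n) \<le> 2 * real n powr 2" for n
    using of_nat_mono[OF max_chains_2_le, of n, where 'a = real]
    by (cases "n = 0") (simp_all add: powr_numeral)
  then show ?case unfolding chain_exponent_base
    by (intro bigoI[of _ 2] always_eventually allI) simp
next
  case (step k)
  then show ?case
    unfolding chain_exponent_rec by (intro max_chains_bigo_step chain_exponent_mono)
qed

theorem theorem1p1:
  fixes k :: nat
  assumes "k \<ge> 3"
  shows "(\<lambda>n. real (max_chains k n)) \<in>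
           O(\<lambda>n. real n powr (2 * real k / 5 + 1 + chain_gamma k))"
  using max_chains_bigo[of k] unfolding chain_exponent_def .

end
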